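(* Let $E$ be a vector bundle over a manifold $M$, and let $u_M\colon C^\infty(M)\to C^\infty(M)$ and $u\colon\Gamma E\to\Gamma E$ be $\mathbb R$-linear maps. Then $u_M+u$ is a derivation of the $\mathbb R$-algebra $\mathcal A(E)$ if and only if (i) $u_M$ is a derivation of $C^\infty(M)$, and (ii) $u$ is a derivative endomorphism of $\Gamma E$ with associated derivation $u_M$ of $C^\infty(M)$.
   Context: All manifolds are smooth and second countable. $C^\infty(M)$ is the algebra of smooth real-valued functions on $M$ and $\Gamma E$ the $C^\infty(M)$-module of smooth sections of $E$. $\mathcal A(E)$ is the vector space $C^\infty(M)\oplus\Gamma E$ with the commutative $\mathbb R$-algebra structure in which the product of two elements of $C^\infty(M)$ is their product in $C^\infty(M)$, the product of $f\in C^\infty(M)$ and $\psi\in\Gamma E$ is $f\psi$ in the $C^\infty(M)$-module $\Gamma E$, and the product of any two elements of $\Gamma E$ is zero. $u_M+u$ denotes the linear endomorphism of $\mathcal A(E)$ equal to $u_M$ on $C^\infty(M)$ and to $u$ on $\Gamma E$. $u$ is a derivative endomorphism of $\Gamma E$ with associated derivation $u_M$ if $u$ is $\mathbb R$-linear and $u(f\psi)=fu(\psi)+u_M(f)\psi$ for all $f\in C^\infty(M)$, $\psi\in\Gamma E$. *)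

theory Defs
  imports "HOL-Analysis.Analysis" "HOL-Algebra.Algebraic_Closure_Type"
begin

section \<open>Smooth functions on open subsets of Euclidean space\<close>

text \<open>
  The space of dimension \<open>n\<close> is the topological space \<^term>\<open>Euclidean_space n\<close> of real sequences
  that vanish from index \<open>n\<close> on, so that \<open>n\<close> is an ordinary natural number and may be \<open>0\<close>.
  Smoothness on an open set means that the iterated partial derivatives of all orders exist
  and are continuous. The predicates below are meant for open sets \<open>S\<close> only.
\<close>

definition partial_deriv :: "nat \<Rightarrow> ((nat \<Rightarrow> real) \<Rightarrow> real) \<Rightarrow> (nat \<Rightarrow> real) \<Rightarrow> real" where
  "partial_deriv i f x = deriv (\<lambda>t. f (x(i := t))) (x i)"

primrec Ck_on ::
  "nat \<Rightarrow> nat \<Rightarrow> (nat \<Rightarrow> real) set \<Rightarrow> ((nat \<Rightarrow> real) \<Rightarrow> real) \<Rightarrow> bool" where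
  "Ck_on 0 n S f \<longleftrightarrow>
     continuous_map (subtopology (Euclidean_space n) S) euclideanreal f"
| "Ck_on (Suc k) n S f \<longleftrightarrow>
     continuous_map (subtopology (Euclidean_space n) S) euclideanreal f \<and>
     (\<forall>i<n. (\<forall>x\<in>S. (\<lambda>t. f (x(i := t))) field_differentiable at (x i)) \<and>
            Ck_on k n S (partial_deriv i f))"

definition smooth_on :: "nat \<Rightarrow> (nat \<Rightarrow> real) set \<Rightarrow> ((nat \<Rightarrow> real) \<Rightarrow> real) \<Rightarrow> bool" where
  "smooth_on n S f \<longleftrightarrow> (\<forall>k. Ck_on k n S f)"

definition smooth_into ::
  "nat \<Rightarrow> nat \<Rightarrow> (nat \<Rightarrow> real) set \<Rightarrow> ((nat \<Rightarrow> real) \<Rightarrow> (nat \<Rightarrow> real)) \<Rightarrow> bool" where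
  "smooth_into n m S F \<longleftrightarrow> (\<forall>j<m. smooth_on n S (\<lambda>x. F x j))"


section \<open>Smooth manifolds\<close>

text \<open>
  A chart is a pair of its open domain and its coordinate map. The atlas is any smooth atlas, not
  necessarily the maximal one that it determines.
\<close>

record 'a manifold =
  man_top :: "'a topology"
  man_dim :: nat
  man_charts :: "('a set \<times> ('a \<Rightarrow> nat \<Rightarrow> real)) set"

definition smooth_manifold :: "'a manifold \<Rightarrow> bool" where
  "smooth_manifold M \<longleftrightarrow>
     Hausdorff_space (man_top M) \<and> second_countable (man_top M) \<and>
     (\<forall>(U, \<phi>) \<in> man_charts M.
        openin (man_top M) U \<and> openin (Euclidean_space (man_dim M)) (\<phi> ` U) \<and>
        homeomorphic_map (subtopology (man_top M) U)
          (subtopology (Euclidean_space (man_dim M)) (\<phi> ` U)) \<phi>) \<and>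
     topspace (man_top M) = (\<Union>(U, \<phi>) \<in> man_charts M. U) \<and>
     (\<forall>(U, \<phi>) \<in> man_charts M. \<forall>(V, \<psi>) \<in> man_charts M.
        smooth_into (man_dim M) (man_dim M) (\<phi> ` (U \<inter> V)) (\<lambda>x. \<psi> (inv_into U \<phi> x)))"

definition smooth_map :: "'a manifold \<Rightarrow> 'b manifold \<Rightarrow> ('a \<Rightarrow> 'b) \<Rightarrow> bool" where
  "smooth_map M N f \<longleftrightarrow>
     continuous_map (man_top M) (man_top N) f \<and>
     (\<forall>(U, \<phi>) \<in> man_charts M. \<forall>(V, \<psi>) \<in> man_charts N.
        smooth_into (man_dim M) (man_dim N) (\<phi> ` {p \<in> U. f p \<in> V})
          (\<lambda>x. \<psi> (f (inv_into U \<phi> x))))"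

definition diffeomorphism :: "'a manifold \<Rightarrow> 'b manifold \<Rightarrow> ('a \<Rightarrow> 'b) \<Rightarrow> bool" where
  "diffeomorphism M N f \<longleftrightarrow>
     smooth_map M N f \<and>
     (\<exists>g. smooth_map N M g \<and> (\<forall>x \<in> topspace (man_top M). g (f x) = x) \<and>
          (\<forall>y \<in> topspace (man_top N). f (g y) = y))"

definition euclidean_manifold :: "nat \<Rightarrow> (nat \<Rightarrow> real) manifold" where
  "euclidean_manifold n =
     \<lparr>man_top = Euclidean_space n, man_dim = n,
      man_charts = {(topspace (Euclidean_space n), \<lambda>x. x)}\<rparr>"

definition open_submanifold :: "'a manifold \<Rightarrow> 'a set \<Rightarrow> 'a manifold" where
  "open_submanifold M W =
     \<lparr>man_top = subtopology (man_top M) W, man_dim = man_dim M,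
      man_charts = {(U \<inter> W, \<phi>) |U \<phi>. (U, \<phi>) \<in> man_charts M}\<rparr>"

definition prod_manifold :: "'a manifold \<Rightarrow> 'b manifold \<Rightarrow> ('a \<times> 'b) manifold" where
  "prod_manifold M N =
     \<lparr>man_top = prod_topology (man_top M) (man_top N), man_dim = man_dim M + man_dim N,
      man_charts =
        {(U \<times> V, \<lambda>(x, y) i. if i < man_dim M then \<phi> x i else \<psi> y (i - man_dim M)) |U \<phi> V \<psi>.
           (U, \<phi>) \<in> man_charts M \<and> (V, \<psi>) \<in> man_charts N}\<rparr>"


section \<open>Modules, linear maps and derivations\<close>

text \<open>
  Modules are HOL-Algebra records; the locale \<^locale>\<open>module\<close> ignores the fields
  \<open>mult\<close> and \<open>one\<close> of the record, which are left undefined where there is no multiplication.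
\<close>

abbreviation real_ring :: "real ring" where
  "real_ring \<equiv> ring_of_type_algebra"

definition linear_maps ::
  "'r ring \<Rightarrow> ('r, 'v) module \<Rightarrow> ('r, 'w) module \<Rightarrow> ('v \<Rightarrow> 'w) set" where
  "linear_maps R V W =
     {T \<in> carrier V \<rightarrow> carrier W.
        (\<forall>x \<in> carrier V. \<forall>y \<in> carrier V. T (x \<oplus>\<^bsub>V\<^esub> y) = T x \<oplus>\<^bsub>W\<^esub> T y) \<and>
        (\<forall>c \<in> carrier R. \<forall>x \<in> carrier V. T (c \<odot>\<^bsub>V\<^esub> x) = c \<odot>\<^bsub>W\<^esub> T x)}"

definition derivation :: "'r ring \<Rightarrow> ('r, 'b) module \<Rightarrow> ('b \<Rightarrow> 'b) \<Rightarrow> bool" where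
  "derivation R A D \<longleftrightarrow>
     D \<in> linear_maps R A A \<and>
     (\<forall>a \<in> carrier A. \<forall>b \<in> carrier A. D (a \<otimes>\<^bsub>A\<^esub> b) = D a \<otimes>\<^bsub>A\<^esub> b \<oplus>\<^bsub>A\<^esub> a \<otimes>\<^bsub>A\<^esub> D b)"

definition coord_space :: "nat \<Rightarrow> (real, nat \<Rightarrow> real) module" where
  "coord_space n =
     \<lparr>carrier = topspace (Euclidean_space n), monoid.mult = undefined, one = undefined,
      zero = (\<lambda>i. 0), add = (\<lambda>x y i. x i + y i), smult = (\<lambda>c x i. c * x i)\<rparr>"

text \<open>For an \<open>R\<close>-algebra \<open>C\<close>, scalars \<open>c\<close> act on a \<open>C\<close>-module through \<open>c \<odot> \<one>\<close>.\<close>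

definition restrict_scalars :: "('r, 'c) module \<Rightarrow> ('c, 'v) module \<Rightarrow> ('r, 'v) module" where
  "restrict_scalars C V =
     \<lparr>carrier = carrier V, monoid.mult = monoid.mult V, one = one V, zero = zero V, add = add V,
      smult = (\<lambda>c v. (c \<odot>\<^bsub>C\<^esub> \<one>\<^bsub>C\<^esub>) \<odot>\<^bsub>V\<^esub> v)\<rparr>"

definition square_zero_extension ::
  "('r, 'c) module \<Rightarrow> ('c, 'v) module \<Rightarrow> ('r, 'c \<times> 'v) module" where
  "square_zero_extension C V =
     \<lparr>carrier = carrier C \<times> carrier V,
      monoid.mult = (\<lambda>(f, v) (g, w). (f \<otimes>\<^bsub>C\<^esub> g, f \<odot>\<^bsub>V\<^esub> w \<oplus>\<^bsub>V\<^esub> g \<odot>\<^bsub>V\<^esub> v)),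
      one = (\<one>\<^bsub>C\<^esub>, \<zero>\<^bsub>V\<^esub>),
      zero = (\<zero>\<^bsub>C\<^esub>, \<zero>\<^bsub>V\<^esub>),
      add = (\<lambda>(f, v) (g, w). (f \<oplus>\<^bsub>C\<^esub> g, v \<oplus>\<^bsub>V\<^esub> w)),
      smult = (\<lambda>c (f, v). (c \<odot>\<^bsub>C\<^esub> f, c \<odot>\<^bsub>restrict_scalars C V\<^esub> v))\<rparr>"


section \<open>Vector bundles\<close>

record ('a, 'e) vbundle =
  total_space :: "'e manifold"
  bundle_proj :: "'e \<Rightarrow> 'a"
  fibre :: "'a \<Rightarrow> (real, 'e) module"

definition bundle_over :: "('a, 'e) vbundle \<Rightarrow> 'a set \<Rightarrow> 'e set" where
  "bundle_over E U = {e \<in> topspace (man_top (total_space E)). bundle_proj E e \<in> U}"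

definition local_trivialization ::
  "nat \<Rightarrow> 'a manifold \<Rightarrow> ('a, 'e) vbundle \<Rightarrow> 'a set \<Rightarrow> ('e \<Rightarrow> 'a \<times> (nat \<Rightarrow> real)) \<Rightarrow> bool" where
  "local_trivialization r M E U \<Phi> \<longleftrightarrow>
     openin (man_top M) U \<and>
     diffeomorphism (open_submanifold (total_space E) (bundle_over E U))
       (prod_manifold (open_submanifold M U) (euclidean_manifold r)) \<Phi> \<and>
     (\<forall>e \<in> bundle_over E U. fst (\<Phi> e) = bundle_proj E e) \<and>
     (\<forall>p \<in> U. (\<lambda>e. snd (\<Phi> e)) \<in> linear_maps real_ring (fibre E p) (coord_space r) \<and>
              bij_betw (\<lambda>e. snd (\<Phi> e)) (carrier (fibre E p)) (carrier (coord_space r)))"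

definition vector_bundle :: "nat \<Rightarrow> 'a manifold \<Rightarrow> ('a, 'e) vbundle \<Rightarrow> bool" where
  "vector_bundle r M E \<longleftrightarrow>
     smooth_manifold M \<and> smooth_manifold (total_space E) \<and>
     smooth_map (total_space E) M (bundle_proj E) \<and>
     bundle_proj E ` topspace (man_top (total_space E)) = topspace (man_top M) \<and>
     (\<forall>p \<in> topspace (man_top M).
        carrier (fibre E p) = bundle_over E {p} \<and> module real_ring (fibre E p)) \<and>
     (\<forall>p \<in> topspace (man_top M). \<exists>U \<Phi>. p \<in> U \<and> local_trivialization r M E U \<Phi>)"


section \<open>Smooth functions, smooth sections and the algebra of a vector bundle\<close>

text \<open>
  Functions and sections are represented by extensional HOL functions, that is, they take the value
  \<^term>\<open>undefined\<close> outside the point set of the manifold, so that equality is equality on the manifold.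
\<close>

definition smooth_functions :: "'a manifold \<Rightarrow> (real, 'a \<Rightarrow> real) module" where
  "smooth_functions M =
     (let S = topspace (man_top M) in
     \<lparr>carrier = {f \<in> extensional S. \<forall>(U, \<phi>) \<in> man_charts M.
        smooth_on (man_dim M) (\<phi> ` U) (\<lambda>x. f (inv_into U \<phi> x))},
      monoid.mult = (\<lambda>f g. \<lambda>p\<in>S. f p * g p),
      one = (\<lambda>p\<in>S. 1),
      zero = (\<lambda>p\<in>S. 0),
      add = (\<lambda>f g. \<lambda>p\<in>S. f p + g p),
      smult = (\<lambda>c f. \<lambda>p\<in>S. c * f p)\<rparr>)"

text \<open>The module of sections over the algebra of smooth functions.\<close>

definition smooth_sections ::
  "'a manifold \<Rightarrow> ('a, 'e) vbundle \<Rightarrow> ('a \<Rightarrow> real, 'a \<Rightarrow> 'e) module" where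
  "smooth_sections M E =
     (let S = topspace (man_top M) in
     \<lparr>carrier = {\<psi> \<in> extensional S. smooth_map M (total_space E) \<psi> \<and>
                   (\<forall>p \<in> S. bundle_proj E (\<psi> p) = p)},
      monoid.mult = undefined,
      one = undefined,
      zero = (\<lambda>p\<in>S. \<zero>\<^bsub>fibre E p\<^esub>),
      add = (\<lambda>\<psi> \<eta>. \<lambda>p\<in>S. \<psi> p \<oplus>\<^bsub>fibre E p\<^esub> \<eta> p),
      smult = (\<lambda>f \<psi>. \<lambda>p\<in>S. f p \<odot>\<^bsub>fibre E p\<^esub> \<psi> p)\<rparr>)"

definition section_space ::
  "'a manifold \<Rightarrow> ('a, 'e) vbundle \<Rightarrow> (real, 'a \<Rightarrow> 'e) module" where
  "section_space M E = restrict_scalars (smooth_functions M) (smooth_sections M E)"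

definition bundle_algebra ::
  "'a manifold \<Rightarrow> ('a, 'e) vbundle \<Rightarrow> (real, ('a \<Rightarrow> real) \<times> ('a \<Rightarrow> 'e)) module" where
  "bundle_algebra M E = square_zero_extension (smooth_functions M) (smooth_sections M E)"

definition derivative_endomorphism ::
  "'a manifold \<Rightarrow> ('a, 'e) vbundle \<Rightarrow> (('a \<Rightarrow> real) \<Rightarrow> 'a \<Rightarrow> real) \<Rightarrow> (('a \<Rightarrow> 'e) \<Rightarrow> 'a \<Rightarrow> 'e) \<Rightarrow> bool" where
  "derivative_endomorphism M E u\<^sub>M u \<longleftrightarrow>
     u \<in> linear_maps real_ring (section_space M E) (section_space M E) \<and>
     (\<forall>f \<in> carrier (smooth_functions M). \<forall>\<psi> \<in> carrier (smooth_sections M E).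
        u (f \<odot>\<^bsub>smooth_sections M E\<^esub> \<psi>) =
          f \<odot>\<^bsub>smooth_sections M E\<^esub> u \<psi> \<oplus>\<^bsub>smooth_sections M E\<^esub> u\<^sub>M f \<odot>\<^bsub>smooth_sections M E\<^esub> \<psi>)"

end

theory Submission
  imports Defs
begin

text \<open>
  The product of \<open>(f, v)\<close> and \<open>(g, w)\<close> in the algebra is \<open>(f g, f w + g v)\<close>, so the Leibniz rule for
  \<open>u\<^sub>M + u\<close> splits into the Leibniz rule for \<open>u\<^sub>M\<close> and an identity of sections, which for \<open>g = f\<close> and
  \<open>v = 0\<close> is the condition on \<open>u\<close>; conversely, it is the sum of two instances of that condition.
  This uses that the zero section is smooth and that \<open>f v\<close> is a smooth section, which is where the
  bundle structure and the chain rule enter: a section is smooth if and only if its coordinates in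
  all local trivializations are, and these depend linearly on the section.
\<close>

section \<open>Calculus on Euclidean space\<close>

text \<open>\<open>vector_bundle\<close> asks for module structures on the fibres and for
  trivializations that are linear on each of them, so smoothness of \<open>f v\<close> has to be
  carried through a trivialization \<Phi>. On the way down, \<open>v\<close> is followed by \<Phi>
  and by the second projection; the coordinates are then multiplied by \<open>f\<close>; on the way
  up, the graph map of the coordinates is followed by the inverse of \<Phi>. Both ways compose
  smooth maps between manifolds whose atlases need not be maximal, so a composite read in charts
  passes through a chart of the middle manifold that is available only near a point. Hence the
  weight of the locality lemmas and of the openness of chart images. Coordinates live in
  \<open>nat \<Rightarrow> real\<close> with the dimension as a number, so differentiation goes one
  coordinate at a time along \<open>x(i := t)\<close>. In the final algebra every smooth
  \<open>g\<close> would isolate the condition on \<open>u\<close> once \<open>v = 0\<close>;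
  \<open>g = f\<close> is a smooth function already at hand. The remaining terms vanish because
  \<open>u\<close> fixes the zero section.\<close>

lemma upd_in_topspace_Euclidean_space [simp]:
  assumes "x \<in> topspace (Euclidean_space n)" "i < n"
  shows "x(i := t) \<in> topspace (Euclidean_space n)"
  using assms by (auto simp: topspace_Euclidean_space)

text \<open>Two points of the space agree from index \<open>n\<close> on, so a product neighbourhood
  constrains only finitely many coordinates and a single radius serves for all of them.\<close>

lemma openin_Euclidean_space_box:
  assumes "openin (Euclidean_space n) S" "x \<in> S"
  obtains e where "e > 0"
    "\<And>y. y \<in> topspace (Euclidean_space n) \<Longrightarrow> (\<And>i. i < n \<Longrightarrow> \<bar>y i - x i\<bar> < e) \<Longrightarrow> y \<in> S"
proof -
  have xs: "x \<in> topspace (Euclidean_space n)"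
    using assms openin_subset by blast
  obtain W where W: "openin (powertop_real UNIV) W" "S = W \<inter> {x. \<forall>i\<ge>n. x i = 0}"
    using assms(1) unfolding Euclidean_space_def openin_subtopology by blast
  then obtain Y where Y: "finite {i. Y i \<noteq> (UNIV :: real set)}" "\<And>i. open (Y i)"
      "x \<in> PiE UNIV Y" "PiE UNIV Y \<subseteq> W"
    using assms(2) by (auto simp: openin_product_topology_alt)
  have "\<exists>e>0. \<forall>y. \<bar>y - x i\<bar> < e \<longrightarrow> y \<in> Y i" for i
  proof -
    have "x i \<in> Y i" using Y(3) by auto
    then show ?thesis using Y(2)[of i] unfolding open_dist dist_real_def by blast
  qed
  then obtain e where e: "\<And>i. e i > 0" "\<And>i y. \<bar>y - x i\<bar> < e i \<Longrightarrow> y \<in> Y i"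
    by metis
  \<comment> \<open>The 1 keeps the set nonempty when \<open>n = 0\<close>.\<close>
  define d where "d = Min (insert 1 (e ` {..<n}))"
  have d: "d > 0" "\<And>i. i < n \<Longrightarrow> d \<le> e i"
    using e(1) by (auto simp: d_def)
  have "y \<in> S" if y: "y \<in> topspace (Euclidean_space n)" "\<And>i. i < n \<Longrightarrow> \<bar>y i - x i\<bar> < d" for y
  proof -
    have "y i \<in> Y i" for i
    proof (cases "i < n")
      case True
      then show ?thesis using y(2)[of i] d(2)[of i] e(2) by force
    next
      case False
      then have "y i = x i" using y xs by (auto simp: topspace_Euclidean_space)
      then show ?thesis using Y(3) by auto
    qed
    then show ?thesis using Y(4) y W(2) by (auto simp: topspace_Euclidean_space)
  qed
  with d(1) show ?thesis using that by blast
qed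

text \<open>This makes partial derivatives local: the one-variable functions that define them see
  only points of \<open>S\<close> near \<open>x i\<close>.\<close>

lemma eventually_upd_mem:
  assumes "openin (Euclidean_space n) S" "x \<in> S" "i < n"
  shows "eventually (\<lambda>t. x(i := t) \<in> S) (nhds (x i))"
proof -
  obtain e where e: "e > 0"
    "\<And>y. y \<in> topspace (Euclidean_space n) \<Longrightarrow> (\<And>i. i < n \<Longrightarrow> \<bar>y i - x i\<bar> < e) \<Longrightarrow> y \<in> S"
    using openin_Euclidean_space_box assms by blast
  have "x \<in> topspace (Euclidean_space n)" using assms openin_subset by blast
  then have "x(i := t) \<in> S" if "dist t (x i) < e" for t
    using that e assms(3) by (auto simp: dist_real_def intro!: e(2))
  then show ?thesis using e(1) unfolding eventually_nhds_metric by blast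
qed

text \<open>Epsilon-delta continuity in boxes, the form in which the chain rule uses continuity of
  partial derivatives. The set where \<open>f\<close> is \<open>e\<close>-close to
  \<open>f x\<close> is open in \<open>S\<close>, hence in the whole space since \<open>S\<close> is
  open.\<close>

lemma Ck_on_0_box:
  assumes "openin (Euclidean_space n) S" "x \<in> S" "Ck_on 0 n S f" "e > 0"
  obtains d where "d > 0"
    "\<And>y. y \<in> topspace (Euclidean_space n) \<Longrightarrow> (\<And>i. i < n \<Longrightarrow> \<bar>y i - x i\<bar> < d) \<Longrightarrow>
       y \<in> S \<and> \<bar>f y - f x\<bar> < e"
proof -
  have top: "topspace (subtopology (Euclidean_space n) S) = S"
    using openin_subset[OF assms(1)] by (simp add: Int_absorb1)
  have "openin (subtopology (Euclidean_space n) S)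
     {y \<in> topspace (subtopology (Euclidean_space n) S). f y \<in> ball (f x) e}"
    by (rule openin_continuous_map_preimage[OF assms(3)[unfolded Ck_on.simps]]) simp
  from openin_trans_full[OF this assms(1)]
  have "openin (Euclidean_space n) {y \<in> S. f y \<in> ball (f x) e}"
    unfolding top .
  from openin_Euclidean_space_box[OF this, of x] that assms(2,4) show ?thesis
    by (auto simp: dist_real_def abs_minus_commute)
qed

section \<open>Locality and algebra of the classes C^k\<close>

lemma Ck_on_imp_continuous:
  "Ck_on k n S f \<Longrightarrow> continuous_map (subtopology (Euclidean_space n) S) euclideanreal f"
  by (cases k) auto

lemma Ck_on_imp_Ck_on_0: "Ck_on k n S f \<Longrightarrow> Ck_on 0 n S f"
  by (simp add: Ck_on_imp_continuous)

lemma Ck_on_Suc_has_derivative: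
  assumes "Ck_on (Suc k) n S f" "x \<in> S" "i < n"
  shows "((\<lambda>t. f (x(i := t))) has_field_derivative partial_deriv i f x) (at (x i))"
  using assms unfolding partial_deriv_def
  by (auto simp: DERIV_deriv_iff_field_differentiable)

lemma Ck_on_subset:
  assumes "Ck_on k n S f" "T \<subseteq> S"
  shows "Ck_on k n T f"
  using assms
proof (induction k arbitrary: f)
  case 0
  then show ?case
    by (simp add: continuous_map_from_subtopology_mono)
next
  case (Suc k)
  then show ?case
    using continuous_map_from_subtopology_mono by fastforce
qed

text \<open>A partial derivative at \<open>x\<close> also reads values at \<open>x(i := t)\<close>;
  openness of \<open>S\<close> puts these points into \<open>S\<close> for \<open>t\<close> near
  \<open>x i\<close>, so equality on \<open>S\<close> passes to all derivatives.\<close>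

lemma Ck_on_cong:
  assumes "openin (Euclidean_space n) S" "\<And>x. x \<in> S \<Longrightarrow> f x = g x" "Ck_on k n S f"
  shows "Ck_on k n S g"
  using assms(2,3)
proof (induction k arbitrary: f g)
  case 0
  then show ?case
    by (auto elim: continuous_map_eq)
next
  case (Suc k)
  have ev: "eventually (\<lambda>t. f (x(i := t)) = g (x(i := t))) (nhds (x i))"
    if "x \<in> S" "i < n" for x i
    using eventually_upd_mem[OF assms(1) that] by eventually_elim (use Suc.prems(1) in auto)
  have "continuous_map (subtopology (Euclidean_space n) S) euclideanreal g"
    using Suc.prems by (auto elim: continuous_map_eq)
  moreover have "(\<lambda>t. g (x(i := t))) field_differentiable at (x i)" if "x \<in> S" "i < n" for x i
    using Ck_on_Suc_has_derivative[OF Suc.prems(2) that] DERIV_cong_ev[OF refl ev[OF that] refl]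
    unfolding field_differentiable_def by blast
  moreover have "partial_deriv i f x = partial_deriv i g x" if "x \<in> S" "i < n" for x i
    unfolding partial_deriv_def by (rule deriv_cong_ev[OF ev[OF that] refl])
  then have "Ck_on k n S (partial_deriv i g)" if "i < n" for i
    using Suc.IH[of "partial_deriv i f" "partial_deriv i g"] Suc.prems(2) that by auto
  ultimately show ?case by simp
qed

text \<open>Lets an explicit formula \<open>D\<close> stand in for \<open>partial_deriv\<close>. The
  two agree on \<open>S\<close>, and \<open>Ck_on_cong\<close> transfers regularity between
  them.\<close>

lemma Ck_on_SucI:
  assumes "openin (Euclidean_space n) S"
    and "continuous_map (subtopology (Euclidean_space n) S) euclideanreal f"
    and D: "\<And>i x. i < n \<Longrightarrow> x \<in> S \<Longrightarrow> ((\<lambda>t. f (x(i := t))) has_field_derivative D i x) (at (x i))"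
    and "\<And>i. i < n \<Longrightarrow> Ck_on k n S (D i)"
  shows "Ck_on (Suc k) n S f"
proof -
  have "D i x = partial_deriv i f x" if "i < n" "x \<in> S" for i x
    using DERIV_imp_deriv[OF D[OF that]] by (simp add: partial_deriv_def)
  then have "Ck_on k n S (partial_deriv i f)" if "i < n" for i
    using that assms(1,4) Ck_on_cong by blast
  moreover have "(\<lambda>t. f (x(i := t))) field_differentiable at (x i)" if "x \<in> S" "i < n" for x i
    using D[OF that(2,1)] by (auto simp: field_differentiable_def)
  ultimately show ?thesis using assms(2) by simp
qed

lemma Ck_on_Suc_imp_Ck_on: "Ck_on (Suc k) n S f \<Longrightarrow> Ck_on k n S f"
proof (induction k arbitrary: f)
  case 0
  then show ?case by simp
next
  case (Suc k)
  have "Ck_on k n S (partial_deriv i f)" if "i < n" for i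
    by (rule Suc.IH) (use Suc.prems that in \<open>simp only: Ck_on.simps(2)[of "Suc k"]\<close>)
  with Suc.prems show ?case
    unfolding Ck_on.simps(2)[of "Suc k"] Ck_on.simps(2)[of k] by blast
qed

lemma continuous_map_local:
  assumes "\<And>x. x \<in> topspace Y \<Longrightarrow> \<exists>T. openin Y T \<and> x \<in> T \<and> continuous_map (subtopology Y T) Z f"
  shows "continuous_map Y Z f"
proof -
  from assms have "\<forall>x\<in>topspace Y. \<exists>T. openin Y T \<and> x \<in> T \<and> continuous_map (subtopology Y T) Z f"
    by (rule ballI)
  \<comment> \<open>The pasting lemma wants an indexed cover; the points themselves serve as
    indices.\<close>
  from bchoice[OF this] obtain T where T: "\<forall>x\<in>topspace Y.
      openin Y (T x) \<and> x \<in> T x \<and> continuous_map (subtopology Y (T x)) Z f"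
    by (rule exE)
  show ?thesis
  proof (rule pasting_lemma)
    show "\<exists>x'. x' \<in> topspace Y \<and> x \<in> T x' \<and> f x = f x" if "x \<in> topspace Y" for x
      using T that by (intro exI[of _ x]) simp
  qed (use T in simp_all)
qed

lemma Ck_on_local:
  assumes "\<And>x. x \<in> S \<Longrightarrow> \<exists>T. openin (Euclidean_space n) T \<and> x \<in> T \<and> T \<subseteq> S \<and> Ck_on k n T f"
  shows "Ck_on k n S f"
  using assms
proof (induction k arbitrary: f)
  case 0
  \<comment> \<open>\<open>S\<close> is the union of the neighbourhoods \<open>T\<close>, hence
    open.\<close>
  have S: "openin (Euclidean_space n) S"
  proof (subst openin_subopen, rule ballI)
    fix x assume "x \<in> S"
    from 0[OF this] show "\<exists>T. openin (Euclidean_space n) T \<and> x \<in> T \<and> T \<subseteq> S"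
      by blast
  qed
  show ?case
    unfolding Ck_on.simps
  proof (rule continuous_map_local)
    fix x assume "x \<in> topspace (subtopology (Euclidean_space n) S)"
    then have "x \<in> S" by simp
    from 0[OF this] obtain T where T: "openin (Euclidean_space n) T" "x \<in> T" "T \<subseteq> S" "Ck_on 0 n T f"
      by blast
    then show "\<exists>T. openin (subtopology (Euclidean_space n) S) T \<and> x \<in> T \<and>
        continuous_map (subtopology (subtopology (Euclidean_space n) S) T) euclideanreal f"
      by (intro exI[of _ T]) (simp add: S openin_open_subtopology subtopology_subtopology Int_absorb1 del: Int_iff)
  qed
next
  case (Suc k)
  \<comment> \<open>Level \<open>k\<close> for \<open>f\<close> itself serves to extract its
    continuity, the first clause of level \<open>Suc k\<close>.\<close>
  have "Ck_on k n S f"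
  proof (rule Suc.IH)
    fix x assume "x \<in> S"
    from Suc.prems[OF this]
    obtain T where T: "openin (Euclidean_space n) T" "x \<in> T" "T \<subseteq> S" "Ck_on (Suc k) n T f"
      by blast
    show "\<exists>T. openin (Euclidean_space n) T \<and> x \<in> T \<and> T \<subseteq> S \<and> Ck_on k n T f"
      using T(1-3) Ck_on_Suc_imp_Ck_on[OF T(4)] by blast
  qed
  moreover have "Ck_on k n S (partial_deriv i f)" if "i < n" for i
  proof (rule Suc.IH)
    fix x assume "x \<in> S"
    from Suc.prems[OF this]
    obtain T where "openin (Euclidean_space n) T" "x \<in> T" "T \<subseteq> S" "Ck_on (Suc k) n T f"
      by blast
    then show "\<exists>T. openin (Euclidean_space n) T \<and> x \<in> T \<and> T \<subseteq> S \<and> Ck_on k n T (partial_deriv i f)"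
      using \<open>i < n\<close> by (intro exI[of _ T]) simp
  qed
  moreover have "(\<lambda>t. f (x(i := t))) field_differentiable at (x i)" if "x \<in> S" "i < n" for x i
  proof -
    obtain T where "x \<in> T" "Ck_on (Suc k) n T f"
      using Suc.prems[OF \<open>x \<in> S\<close>] by blast
    with \<open>i < n\<close> show ?thesis by simp
  qed
  ultimately show ?case
    unfolding Ck_on.simps using Ck_on_imp_continuous by blast
qed

lemma Ck_on_const: "Ck_on k n S (\<lambda>x. c)"
proof (induction k arbitrary: c)
  case (Suc k)
  have "partial_deriv i (\<lambda>x. c) = (\<lambda>x. 0)" for i
    by (auto simp: partial_deriv_def)
  with Suc show ?case by simp
qed simp

lemma continuous_map_Euclidean_space_proj: "continuous_map (Euclidean_space n) euclideanreal (\<lambda>x. x i)"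
  unfolding Euclidean_space_def
  by (intro continuous_map_from_subtopology continuous_map_product_projection) simp

lemma Ck_on_proj: "Ck_on k n S (\<lambda>x. x j)"
proof -
  have cont: "continuous_map (subtopology (Euclidean_space n) S) euclideanreal (\<lambda>x. x j)"
    by (intro continuous_map_from_subtopology continuous_map_Euclidean_space_proj)
  have "(\<lambda>t. (x(i := t)) j) field_differentiable at (x i)" for x :: "nat \<Rightarrow> real" and i
    by (cases "i = j") (auto simp: field_differentiable_ident field_differentiable_const)
  moreover have "partial_deriv i (\<lambda>x. x j) = (\<lambda>x. if i = j then 1 else 0)" for i
    by (auto simp: partial_deriv_def)
  ultimately show ?thesis
    using cont Ck_on_const by (cases k) (auto simp del: fun_upd_apply)
qed

lemma Ck_on_add:
  assumes S: "openin (Euclidean_space n) S"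
  shows "Ck_on k n S f \<Longrightarrow> Ck_on k n S g \<Longrightarrow> Ck_on k n S (\<lambda>x. f x + g x)"
proof (induction k arbitrary: f g)
  case 0
  then show ?case by (simp add: continuous_map_add)
next
  case (Suc k)
  then show ?case
    by (intro Ck_on_SucI[OF S, where D = "\<lambda>i x. partial_deriv i f x + partial_deriv i g x"]
          derivative_intros Ck_on_Suc_has_derivative continuous_map_add Suc.IH) auto
qed

lemma Ck_on_mult:
  assumes S: "openin (Euclidean_space n) S"
  shows "Ck_on k n S f \<Longrightarrow> Ck_on k n S g \<Longrightarrow> Ck_on k n S (\<lambda>x. f x * g x)"
proof (induction k arbitrary: f g)
  case 0
  then show ?case by (simp add: continuous_map_real_mult)
next
  case (Suc k)
  let ?D = "\<lambda>i x. partial_deriv i f x * g x + partial_deriv i g x * f x"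
  show ?case
  proof (rule Ck_on_SucI[OF S, where D = ?D])
    show "continuous_map (subtopology (Euclidean_space n) S) euclideanreal (\<lambda>x. f x * g x)"
      using Suc.prems by (simp add: continuous_map_real_mult)
    \<comment> \<open>Each product pairs a partial derivative of level \<open>k\<close> with an
      undifferentiated factor, demoted from \<open>Suc k\<close> to \<open>k\<close>, so the
      induction hypothesis applies.\<close>
    show "Ck_on k n S (?D i)" if "i < n" for i
      using that Suc.prems Suc.prems[THEN Ck_on_Suc_imp_Ck_on] by (intro Ck_on_add[OF S] Suc.IH) auto
    show "((\<lambda>t. f (x(i := t)) * g (x(i := t))) has_field_derivative ?D i x) (at (x i))"
      if "i < n" "x \<in> S" for i x
      using DERIV_mult[OF Ck_on_Suc_has_derivative Ck_on_Suc_has_derivative, OF Suc.prems(1) that(2,1) Suc.prems(2) that(2,1)]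
      by (simp only: fun_upd_triv)
  qed
qed

lemma Ck_on_sum:
  assumes "openin (Euclidean_space n) S" "\<And>j. j \<in> J \<Longrightarrow> Ck_on k n S (f j)"
  shows "Ck_on k n S (\<lambda>x. \<Sum>j\<in>J. f j x)"
  using assms(2)
  by (induction J rule: infinite_finite_induct) (auto intro!: Ck_on_const Ck_on_add assms(1))

section \<open>The chain rule\<close>

text \<open>Free of any order between \<open>a\<close> and \<open>b\<close>, since the increment of
  a coordinate along a curve has no known sign.\<close>

lemma mvt_segment_abs:
  fixes f f' :: "real \<Rightarrow> real"
  assumes "\<And>s. \<bar>s - a\<bar> \<le> \<bar>b - a\<bar> \<Longrightarrow> (f has_field_derivative f' s) (at s)"
  obtains s where "\<bar>s - a\<bar> \<le> \<bar>b - a\<bar>" "f b - f a = (b - a) * f' s"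
proof (cases a b rule: linorder_cases)
  case less
  then obtain s where "a < s" "s < b" "f b - f a = (b - a) * f' s"
    using MVT2[of a b f f'] assms by auto
  then show ?thesis using that[of s] by auto
next
  case equal
  then show ?thesis using that[of a] by auto
next
  case greater
  then obtain s where "b < s" "s < a" "f a - f b = (a - b) * f' s"
    using MVT2[of b a f f'] assms by auto
  then show ?thesis using that[of s] by (auto simp: algebra_simps)
qed

text \<open>
  The coordinates are replaced one at a time, and each increment is controlled by the mean value
  theorem in that coordinate, so that continuity of the partial derivatives suffices.
\<close>

lemma DERIV_along_curve:
  assumes T: "openin (Euclidean_space m) T" and g: "Ck_on (Suc 0) m T g"
    and \<gamma>: "\<And>j. j < m \<Longrightarrow> ((\<lambda>t. \<gamma> t j) has_field_derivative \<gamma>' j) (at t0)"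
    and mem: "\<gamma> t0 \<in> T" and ev: "eventually (\<lambda>t. \<gamma> t \<in> topspace (Euclidean_space m)) (nhds t0)"
  shows "((\<lambda>t. g (\<gamma> t)) has_field_derivative (\<Sum>j<m. partial_deriv j g (\<gamma> t0) * \<gamma>' j)) (at t0)"
proof -
  \<comment> \<open>Hybrid points: the first \<open>j\<close> coordinates have already moved to
    \<gamma> at \<open>t\<close>, the others still sit at \<open>t0\<close>. The induction on
    \<open>j\<close> moves one more coordinate.\<close>
  define y where "y = (\<lambda>j t l. if l < j then \<gamma> t l else \<gamma> t0 l)"
  have \<gamma>0: "\<gamma> t0 \<in> topspace (Euclidean_space m)"
    using T mem openin_subset by blast
  have near: "eventually (\<lambda>t. \<forall>j\<in>{..<m}. \<bar>\<gamma> t j - \<gamma> t0 j\<bar> < d) (at t0)" if "d > 0" for d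
  proof (rule eventually_ball_finite, simp, safe)
    fix j assume "j < m"
    then have "((\<lambda>t. \<gamma> t j) \<longlongrightarrow> \<gamma> t0 j) (at t0)"
      using \<gamma> DERIV_isCont isCont_def by blast
    then show "eventually (\<lambda>t. \<bar>\<gamma> t j - \<gamma> t0 j\<bar> < d) (at t0)"
      using that by (auto simp: tendsto_iff dist_real_def)
  qed
  have "((\<lambda>t. g (y j t)) has_field_derivative (\<Sum>l<j. partial_deriv l g (\<gamma> t0) * \<gamma>' l)) (at t0)"
    if "j \<le> m" for j
    using that
  proof (induction j)
    case 0
    then show ?case by (simp add: y_def)
  next
    case (Suc j)
    define c where "c = partial_deriv j g (\<gamma> t0)"
    \<comment> \<open>Difference quotient in the \<open>j\<close>-th coordinate, in the style of
      Caratheodory: the increment of \<open>g\<close> is the coordinate increment times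
      \<open>Q t\<close>, and the derivative follows once \<open>Q\<close> tends to
      \<open>c\<close>. The value \<open>c\<close> covers the case that the coordinate returns to
      its initial value, possibly for \<open>t\<close> arbitrarily close to
      \<open>t0\<close>.\<close>
    define Q where "Q t = (if \<gamma> t j = \<gamma> t0 j then c
      else (g (y (Suc j) t) - g (y j t)) / (\<gamma> t j - \<gamma> t0 j))" for t
    have y_Suc: "y (Suc j) t = (y j t)(j := \<gamma> t j)" for t
      by (auto simp: y_def less_Suc_eq)
    have y_j: "(y j t)(j := \<gamma> t0 j) = y j t" for t
      by (auto simp: y_def)
    have eq: "g (y (Suc j) t) = g (y j t) + (\<gamma> t j - \<gamma> t0 j) * Q t" for t
      using y_Suc[of t] y_j[of t] by (auto simp: Q_def)
    have "(Q \<longlongrightarrow> c) (at t0)"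
    proof (rule tendstoI)
      fix e :: real assume "e > 0"
      have "Ck_on 0 m T (partial_deriv j g)" using g Suc.prems by simp
      from Ck_on_0_box[OF T mem this \<open>e > 0\<close>]
      obtain d where d: "d > 0"
        "\<And>z. z \<in> topspace (Euclidean_space m) \<Longrightarrow> (\<And>i. i < m \<Longrightarrow> \<bar>z i - \<gamma> t0 i\<bar> < d) \<Longrightarrow>
         z \<in> T \<and> \<bar>partial_deriv j g z - c\<bar> < e"
        unfolding c_def by blast
      show "eventually (\<lambda>t. dist (Q t) c < e) (at t0)"
        using near[OF d(1)]
      proof eventually_elim
        case (elim t)
        show ?case
        proof (cases "\<gamma> t j = \<gamma> t0 j")
          case True
          then show ?thesis using \<open>e > 0\<close> by (simp add: Q_def)
        next
          case False
          \<comment> \<open>Each coordinate of such a point equals that of \<gamma> at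
            \<open>t0\<close> or deviates from it at most as much as \<gamma> at \<open>t\<close>
            does, so all these points lie in the same box of radius \<open>d\<close>.\<close>
          have z: "(y j t)(j := s) \<in> T \<and> \<bar>partial_deriv j g ((y j t)(j := s)) - c\<bar> < e"
            if "\<bar>s - \<gamma> t0 j\<bar> \<le> \<bar>\<gamma> t j - \<gamma> t0 j\<bar>" for s
          proof (rule d(2))
            show "(y j t)(j := s) \<in> topspace (Euclidean_space m)"
              using \<gamma>0 Suc.prems by (auto simp: topspace_Euclidean_space y_def)
            show "\<bar>((y j t)(j := s)) i - \<gamma> t0 i\<bar> < d" if "i < m" for i
              using elim that \<open>d > 0\<close> \<open>\<bar>s - \<gamma> t0 j\<bar> \<le> _\<close> by (fastforce simp: y_def)
          qed
          obtain s where s: "\<bar>s - \<gamma> t0 j\<bar> \<le> \<bar>\<gamma> t j - \<gamma> t0 j\<bar>"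
            "g ((y j t)(j := \<gamma> t j)) - g ((y j t)(j := \<gamma> t0 j)) =
              (\<gamma> t j - \<gamma> t0 j) * partial_deriv j g ((y j t)(j := s))"
          proof (rule mvt_segment_abs)
            fix s assume "\<bar>s - \<gamma> t0 j\<bar> \<le> \<bar>\<gamma> t j - \<gamma> t0 j\<bar>"
            from z[OF this] Suc.prems
            show "((\<lambda>s. g ((y j t)(j := s))) has_field_derivative
                partial_deriv j g ((y j t)(j := s))) (at s)"
              using Ck_on_Suc_has_derivative[OF g, of "(y j t)(j := s)" j] by simp
          qed
          then have "Q t = partial_deriv j g ((y j t)(j := s))"
            using False by (simp add: Q_def y_Suc y_j)
          then show ?thesis using z[OF s(1)] by (simp add: dist_real_def)
        qed
      qed
    qed
    moreover have "((\<lambda>t. (\<gamma> t j - \<gamma> t0 j) / (t - t0)) \<longlongrightarrow> \<gamma>' j) (at t0)"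
      using \<gamma>[of j] Suc.prems by (simp add: has_field_derivative_iff)
    ultimately have "((\<lambda>t. (\<gamma> t j - \<gamma> t0 j) / (t - t0) * Q t) \<longlongrightarrow> \<gamma>' j * c) (at t0)"
      by (intro tendsto_mult)
    then have "((\<lambda>t. (\<gamma> t j - \<gamma> t0 j) * Q t) has_field_derivative \<gamma>' j * c) (at t0)"
      by (simp add: has_field_derivative_iff)
    from DERIV_add[OF Suc.IH this] Suc.prems show ?case
      by (simp add: eq c_def mult.commute)
  qed
  from this[of m] have "((\<lambda>t. g (y m t)) has_field_derivative
      (\<Sum>l<m. partial_deriv l g (\<gamma> t0) * \<gamma>' l)) (at t0)"
    by simp
  \<comment> \<open>The last hybrid still has the coordinates of \<open>t0\<close> from index
    \<open>m\<close> on; these are 0, as are those of \<gamma> at \<open>t\<close> once it lies in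
    the space.\<close>
  moreover have "eventually (\<lambda>t. g (y m t) = g (\<gamma> t)) (nhds t0)"
    using ev
  proof eventually_elim
    case (elim t)
    then have "y m t = \<gamma> t" using \<gamma>0 by (auto simp: y_def topspace_Euclidean_space)
    then show ?case by simp
  qed
  ultimately show ?thesis
    by (subst DERIV_cong_ev[OF refl _ refl, symmetric])
qed

lemma continuous_map_Euclidean_space_coordinatewise:
  "continuous_map Y (Euclidean_space m) F \<longleftrightarrow>
     F \<in> topspace Y \<rightarrow> topspace (Euclidean_space m) \<and>
     (\<forall>j<m. continuous_map Y euclideanreal (\<lambda>x. F x j))" (is "?L \<longleftrightarrow> ?R")
proof
  assume L: ?L
  then have "continuous_map Y euclideanreal (\<lambda>x. F x j)" for j
    by (auto simp: Euclidean_space_def continuous_map_in_subtopology continuous_map_componentwise_UNIV)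
  with L show ?R using continuous_map_funspace by blast
next
  assume R: ?R
  \<comment> \<open>The criterion speaks of maps cut off at \<open>m\<close>; the cut-off changes
    nothing, as \<open>F x\<close> vanishes there anyway.\<close>
  then have "continuous_map Y (Euclidean_space m) (\<lambda>x j. if j < m then F x j else 0)"
    by (subst continuous_map_componentwise_Euclidean_space) auto
  moreover have "(\<lambda>j. if j < m then F x j else 0) = F x" if "x \<in> topspace Y" for x
    using R that by (fastforce simp: topspace_Euclidean_space)
  ultimately show ?L by (auto elim: continuous_map_eq)
qed

text \<open>The chain rule expresses a partial derivative of the composite by products of a partial
  derivative of \<open>F\<close> and a composite of the same \<open>F\<close> with a partial
  derivative of \<open>g\<close>. The latter is again of the given shape, one level lower, so the
  induction generalises over \<open>g\<close> and keeps \<open>F\<close> fixed.\<close>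

lemma Ck_on_compose:
  assumes S: "openin (Euclidean_space n) S" and T: "openin (Euclidean_space m) T"
    and FT: "\<And>x. x \<in> S \<Longrightarrow> F x \<in> T"
  shows "(\<And>j. j < m \<Longrightarrow> Ck_on k n S (\<lambda>x. F x j)) \<Longrightarrow> Ck_on k m T g \<Longrightarrow> Ck_on k n S (\<lambda>x. g (F x))"
proof (induction k arbitrary: g)
  case 0
  have "continuous_map (subtopology (Euclidean_space n) S) (subtopology (Euclidean_space m) T) F"
    unfolding continuous_map_in_subtopology continuous_map_Euclidean_space_coordinatewise
    using 0 FT openin_subset[OF T] by auto
  from continuous_map_compose[OF this] 0 show ?case
    by (simp add: o_def)
next
  case (Suc k)
  \<comment> \<open>Composition with any function of level \<open>k\<close>, after demoting the
    components of \<open>F\<close> to that level.\<close>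
  note lower = Suc.IH[OF Ck_on_Suc_imp_Ck_on[OF Suc.prems(1)]]
  let ?D = "\<lambda>i x. \<Sum>j<m. partial_deriv j g (F x) * partial_deriv i (\<lambda>x. F x j) x"
  show ?case
  proof (rule Ck_on_SucI[OF S, where D = ?D])
    show "continuous_map (subtopology (Euclidean_space n) S) euclideanreal (\<lambda>x. g (F x))"
      using lower[OF _ Ck_on_Suc_imp_Ck_on[OF Suc.prems(2)]] Ck_on_imp_continuous by blast
    show "Ck_on k n S (?D i)" if "i < n" for i
      using that Suc.prems by (intro Ck_on_sum[OF S] Ck_on_mult[OF S] lower) auto
    show "((\<lambda>t. g (F (x(i := t)))) has_field_derivative ?D i x) (at (x i))"
      if "i < n" "x \<in> S" for i x
    proof -
      have "Ck_on (Suc 0) m T g"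
        using Suc.prems(2) Ck_on_imp_Ck_on_0 by auto
      moreover have "eventually (\<lambda>t. F (x(i := t)) \<in> topspace (Euclidean_space m)) (nhds (x i))"
        using eventually_upd_mem[OF S that(2,1)]
        by eventually_elim (use FT openin_subset[OF T] in blast)
      ultimately show ?thesis
        using DERIV_along_curve[OF T, where \<gamma> = "\<lambda>t. F (x(i := t))" and g = g and ?t0.0 = "x i"
            and \<gamma>' = "\<lambda>j. partial_deriv i (\<lambda>x. F x j) x"]
          Ck_on_Suc_has_derivative[OF Suc.prems(1) that(2,1)] FT[OF that(2)] by simp
    qed
  qed
qed

section \<open>Transfer from C^k to smooth functions\<close>

lemma smooth_on_subset: "smooth_on n S f \<Longrightarrow> T \<subseteq> S \<Longrightarrow> smooth_on n T f"
  by (auto simp: smooth_on_def intro: Ck_on_subset)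

lemma smooth_on_cong:
  "openin (Euclidean_space n) S \<Longrightarrow> (\<And>x. x \<in> S \<Longrightarrow> f x = g x) \<Longrightarrow> smooth_on n S f \<Longrightarrow> smooth_on n S g"
  unfolding smooth_on_def using Ck_on_cong by blast

lemma smooth_on_local:
  assumes "\<And>x. x \<in> S \<Longrightarrow> \<exists>T. openin (Euclidean_space n) T \<and> x \<in> T \<and> T \<subseteq> S \<and> smooth_on n T f"
  shows "smooth_on n S f"
  unfolding smooth_on_def
proof (intro allI Ck_on_local)
  fix k x assume "x \<in> S"
  then show "\<exists>T. openin (Euclidean_space n) T \<and> x \<in> T \<and> T \<subseteq> S \<and> Ck_on k n T f"
    using assms unfolding smooth_on_def by meson
qed

lemma smooth_on_const: "smooth_on n S (\<lambda>x. c)"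
  by (simp add: smooth_on_def Ck_on_const)

lemma smooth_on_proj: "smooth_on n S (\<lambda>x. x j)"
  by (simp add: smooth_on_def Ck_on_proj)

lemma smooth_on_mult:
  "openin (Euclidean_space n) S \<Longrightarrow> smooth_on n S f \<Longrightarrow> smooth_on n S g \<Longrightarrow> smooth_on n S (\<lambda>x. f x * g x)"
  by (simp add: smooth_on_def Ck_on_mult)

lemma smooth_on_compose:
  assumes "openin (Euclidean_space n) S" "openin (Euclidean_space m) T" "\<And>x. x \<in> S \<Longrightarrow> F x \<in> T"
    and "\<And>j. j < m \<Longrightarrow> smooth_on n S (\<lambda>x. F x j)" "smooth_on m T g"
  shows "smooth_on n S (\<lambda>x. g (F x))"
  using assms(4,5) unfolding smooth_on_def by (auto intro: Ck_on_compose[OF assms(1-3)])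

lemma smooth_on_imp_continuous:
  "smooth_on n S f \<Longrightarrow> continuous_map (subtopology (Euclidean_space n) S) euclideanreal f"
  unfolding smooth_on_def using Ck_on_imp_continuous by blast

section \<open>Smooth maps between manifolds\<close>

text \<open>Isolates the conditions on single charts, on which composition, restriction and gluing
  of smooth maps rest; they are all that is established for product manifolds. Compatibility of
  charts enters through \<open>smooth_manifold_transition\<close>, for the graph map.\<close>

definition charted :: "'a manifold \<Rightarrow> bool" where
  "charted M \<longleftrightarrow>
     (\<forall>(U, \<phi>) \<in> man_charts M.
        openin (man_top M) U \<and> openin (Euclidean_space (man_dim M)) (\<phi> ` U) \<and>
        homeomorphic_map (subtopology (man_top M) U)
          (subtopology (Euclidean_space (man_dim M)) (\<phi> ` U)) \<phi>) \<and>
     topspace (man_top M) = (\<Union>(U, \<phi>) \<in> man_charts M. U)"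

lemma smooth_manifold_imp_charted: "smooth_manifold M \<Longrightarrow> charted M"
  by (simp add: smooth_manifold_def charted_def)

lemma charted_chart_exists:
  assumes "charted M" "p \<in> topspace (man_top M)"
  obtains U \<phi> where "(U, \<phi>) \<in> man_charts M" "p \<in> U"
  using assms by (auto simp: charted_def)

context
  fixes M :: "'a manifold" and U :: "'a set" and \<phi> :: "'a \<Rightarrow> nat \<Rightarrow> real"
  assumes M: "charted M" and chart: "(U, \<phi>) \<in> man_charts M"
begin

lemma chart_open: "openin (man_top M) U"
  using M chart by (auto simp: charted_def)

lemma chart_subset: "U \<subseteq> topspace (man_top M)"
  using chart_open openin_subset by blast

lemma chart_image_open: "openin (Euclidean_space (man_dim M)) (\<phi> ` U)"
  using M chart by (auto simp: charted_def)

lemma chart_homeomorphic: "homeomorphic_map (subtopology (man_top M) U)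
          (subtopology (Euclidean_space (man_dim M)) (\<phi> ` U)) \<phi>"
  using M chart by (auto simp: charted_def)

lemma chart_inj: "inj_on \<phi> U"
  using homeomorphic_imp_injective_map[OF chart_homeomorphic] chart_subset
  by (simp add: Int_absorb1)

text \<open>Source of the openness side conditions that congruence and composition of smooth
  functions carry.\<close>

lemma chart_image_subset_open:
  assumes "openin (man_top M) Y" "Y \<subseteq> U"
  shows "openin (Euclidean_space (man_dim M)) (\<phi> ` Y)"
proof -
  have "openin (subtopology (man_top M) U) Y"
    using assms chart_open by (simp add: openin_open_subtopology)
  then have "openin (subtopology (Euclidean_space (man_dim M)) (\<phi> ` U)) (\<phi> ` Y)"
    using homeomorphic_map_openness_eq[OF chart_homeomorphic] by blast
  then show ?thesis
    using chart_image_open openin_trans_full by blast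
qed

lemma chart_continuous:
  "continuous_map (subtopology (man_top M) U) (Euclidean_space (man_dim M)) \<phi>"
  using homeomorphic_imp_continuous_map[OF chart_homeomorphic] continuous_map_into_fulltopology
  by blast

text \<open>The homeomorphism comes with some inverse; injectivity on \<open>U\<close> identifies it
  with \<open>inv_into\<close>, the inverse in which smoothness is phrased.\<close>

lemma chart_inv_continuous:
  "continuous_map (subtopology (Euclidean_space (man_dim M)) (\<phi> ` U)) (man_top M) (inv_into U \<phi>)"
proof -
  obtain g where g: "homeomorphic_maps (subtopology (man_top M) U)
      (subtopology (Euclidean_space (man_dim M)) (\<phi> ` U)) \<phi> g"
    using chart_homeomorphic homeomorphic_map_maps by blast
  then have "continuous_map (subtopology (Euclidean_space (man_dim M)) (\<phi> ` U)) (man_top M) g"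
    unfolding homeomorphic_maps_def continuous_map_in_subtopology by blast
  moreover have "g x = inv_into U \<phi> x"
    if "x \<in> topspace (subtopology (Euclidean_space (man_dim M)) (\<phi> ` U))" for x
  proof -
    have "x \<in> \<phi> ` U" using that by simp
    then obtain p where "p \<in> U" "x = \<phi> p" by blast
    with g chart_subset chart_inj show ?thesis
      by (auto simp: homeomorphic_maps_def)
  qed
  ultimately show ?thesis by (rule continuous_map_eq)
qed

lemma chart_preimage_open:
  assumes "continuous_map (man_top M) Y f" "openin Y V"
  shows "openin (man_top M) {p \<in> U. f p \<in> V}"
proof -
  have "{p \<in> U. f p \<in> V} = U \<inter> {p \<in> topspace (man_top M). f p \<in> V}"
    using chart_subset by blast
  then show ?thesis
    using chart_open openin_continuous_map_preimage[OF assms] by auto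
qed

end

lemma smooth_map_iff:
  "smooth_map M N f \<longleftrightarrow> continuous_map (man_top M) (man_top N) f \<and>
     (\<forall>U \<phi> V \<psi> j. (U, \<phi>) \<in> man_charts M \<longrightarrow> (V, \<psi>) \<in> man_charts N \<longrightarrow> j < man_dim N \<longrightarrow>
        smooth_on (man_dim M) (\<phi> ` {p \<in> U. f p \<in> V}) (\<lambda>x. \<psi> (f (inv_into U \<phi> x)) j))"
  by (fastforce simp: smooth_map_def smooth_into_def)

lemma smooth_map_continuous: "smooth_map M N f \<Longrightarrow> continuous_map (man_top M) (man_top N) f"
  by (simp add: smooth_map_def)

lemma smooth_map_chartD:
  "smooth_map M N f \<Longrightarrow> (U, \<phi>) \<in> man_charts M \<Longrightarrow> (V, \<psi>) \<in> man_charts N \<Longrightarrow> j < man_dim N \<Longrightarrow>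
     smooth_on (man_dim M) (\<phi> ` {p \<in> U. f p \<in> V}) (\<lambda>x. \<psi> (f (inv_into U \<phi> x)) j)"
  by (simp add: smooth_map_iff)

text \<open>Near \<open>p\<close> a chart \<open>V\<close> of the middle manifold around
  \<open>f p\<close> can be inserted, and the composite in charts becomes a composite of two
  coordinate expressions. As \<open>V\<close> depends on \<open>p\<close>, this happens on the small
  set \<open>?T\<close>, and \<open>smooth_on_local\<close> glues.\<close>

lemma smooth_map_compose:
  assumes M: "charted M" and N: "charted N" and P: "charted P"
    and f: "smooth_map M N f" and g: "smooth_map N P g"
  shows "smooth_map M P (\<lambda>p. g (f p))"
  unfolding smooth_map_iff
proof (intro conjI allI impI)
  show cont: "continuous_map (man_top M) (man_top P) (\<lambda>p. g (f p))"
    using continuous_map_compose[OF smooth_map_continuous[OF f] smooth_map_continuous[OF g]]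
    by (simp add: o_def)
  fix U \<phi> W \<theta> j
  assume U: "(U, \<phi>) \<in> man_charts M" and W: "(W, \<theta>) \<in> man_charts P" and j: "j < man_dim P"
  note inj = chart_inj[OF M U] and W_open = chart_open[OF P W]
  show "smooth_on (man_dim M) (\<phi> ` {p \<in> U. g (f p) \<in> W}) (\<lambda>x. \<theta> (g (f (inv_into U \<phi> x))) j)"
  proof (rule smooth_on_local, elim imageE CollectE conjE)
    fix x p assume x: "x = \<phi> p" "p \<in> U" "g (f p) \<in> W"
    have "f p \<in> topspace (man_top N)"
      using continuous_map_funspace[OF smooth_map_continuous[OF f]] x(2) chart_subset[OF M U] by blast
    then obtain V \<psi> where V: "(V, \<psi>) \<in> man_charts N" "f p \<in> V"
      using charted_chart_exists[OF N] by metis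
    let ?A = "{p \<in> U. f p \<in> V}" and ?B = "{q \<in> V. g q \<in> W}" and ?C = "{p \<in> U. g (f p) \<in> W}"
    let ?T = "\<phi> ` (?A \<inter> ?C)"
    have T: "openin (Euclidean_space (man_dim M)) ?T"
      using chart_preimage_open[OF M U smooth_map_continuous[OF f] chart_open[OF N V(1)]]
        chart_preimage_open[OF M U cont W_open]
      by (intro chart_image_subset_open[OF M U]) auto
    have B: "openin (Euclidean_space (man_dim N)) (\<psi> ` ?B)"
      using chart_preimage_open[OF N V(1) smooth_map_continuous[OF g] W_open]
      by (intro chart_image_subset_open[OF N V(1)]) auto
    have "smooth_on (man_dim M) ?T
        (\<lambda>x. (\<lambda>y. \<theta> (g (inv_into V \<psi> y)) j) (\<psi> (f (inv_into U \<phi> x))))"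
    proof (rule smooth_on_compose[OF T B, where F = "\<lambda>x. \<psi> (f (inv_into U \<phi> x))"])
      show "\<psi> (f (inv_into U \<phi> x)) \<in> \<psi> ` ?B" if "x \<in> ?T" for x
        using that inj by (auto simp: inv_into_f_f)
      show "smooth_on (man_dim M) ?T (\<lambda>x. \<psi> (f (inv_into U \<phi> x)) l)" if "l < man_dim N" for l
        by (rule smooth_on_subset[OF smooth_map_chartD[OF f U V(1) that]]) blast
      show "smooth_on (man_dim N) (\<psi> ` ?B) (\<lambda>y. \<theta> (g (inv_into V \<psi> y)) j)"
        using smooth_map_chartD[OF g V(1) W j] .
    qed
    then have "smooth_on (man_dim M) ?T (\<lambda>x. \<theta> (g (f (inv_into U \<phi> x))) j)"
      by (rule smooth_on_cong[OF T, rotated]) (use inj chart_inj[OF N V(1)] in \<open>auto simp: inv_into_f_f\<close>)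
    with T x V(2)
    show "\<exists>T. openin (Euclidean_space (man_dim M)) T \<and> x \<in> T \<and> T \<subseteq> \<phi> ` ?C \<and>
        smooth_on (man_dim M) T (\<lambda>x. \<theta> (g (f (inv_into U \<phi> x))) j)"
      by (intro exI[of _ ?T]) auto
  qed
qed

lemma smooth_map_cong:
  assumes M: "charted M" and N: "charted N" and f: "smooth_map M N f"
    and eq: "\<And>p. p \<in> topspace (man_top M) \<Longrightarrow> f p = g p"
  shows "smooth_map M N g"
  unfolding smooth_map_iff
proof (intro conjI allI impI)
  show "continuous_map (man_top M) (man_top N) g"
    using continuous_map_eq[OF smooth_map_continuous[OF f]] eq by blast
  fix U \<phi> V \<psi> j
  assume U: "(U, \<phi>) \<in> man_charts M" and V: "(V, \<psi>) \<in> man_charts N" and j: "j < man_dim N"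
  have eq': "f p = g p" if "p \<in> U" for p
    using that eq chart_subset[OF M U] by blast
  then have "{p \<in> U. g p \<in> V} = {p \<in> U. f p \<in> V}" by auto
  moreover have "smooth_on (man_dim M) (\<phi> ` {p \<in> U. f p \<in> V}) (\<lambda>x. \<psi> (g (inv_into U \<phi> x)) j)"
  proof (rule smooth_on_cong)
    show "openin (Euclidean_space (man_dim M)) (\<phi> ` {p \<in> U. f p \<in> V})"
      using chart_preimage_open[OF M U smooth_map_continuous[OF f] chart_open[OF N V]]
      by (intro chart_image_subset_open[OF M U]) auto
  qed (use eq' smooth_map_chartD[OF f U V j] chart_inj[OF M U] in \<open>auto simp: inv_into_f_f\<close>)
  ultimately show "smooth_on (man_dim M) (\<phi> ` {p \<in> U. g p \<in> V}) (\<lambda>x. \<psi> (g (inv_into U \<phi> x)) j)"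
    by simp
qed

section \<open>Open submanifolds, restriction and gluing\<close>

lemma open_submanifold_simps [simp]:
  "man_top (open_submanifold M W) = subtopology (man_top M) W"
  "man_dim (open_submanifold M W) = man_dim M"
  "man_charts (open_submanifold M W) = {(U \<inter> W, \<phi>) |U \<phi>. (U, \<phi>) \<in> man_charts M}"
  by (simp_all add: open_submanifold_def)

text \<open>\<open>open_submanifold\<close> shrinks the domain of a chart and keeps its map, so the
  two chart inverses have to be compared.\<close>

lemma inv_into_Int: "inj_on f A \<Longrightarrow> x \<in> f ` (A \<inter> B) \<Longrightarrow> inv_into (A \<inter> B) f x = inv_into A f x"
  by (auto simp: inv_into_f_f inj_on_Int)

lemma charted_open_submanifold:
  assumes M: "charted M" and W: "openin (man_top M) W"
  shows "charted (open_submanifold M W)"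
  unfolding charted_def
proof (intro conjI ballI, clarsimp simp del: topspace_subtopology)
  fix U \<phi> assume U: "(U, \<phi>) \<in> man_charts M"
  have UW: "openin (man_top M) (U \<inter> W)"
    using chart_open[OF M U] W by blast
  have "homeomorphic_map (subtopology (subtopology (man_top M) U) (U \<inter> W))
    (subtopology (subtopology (Euclidean_space (man_dim M)) (\<phi> ` U)) (\<phi> ` (U \<inter> W))) \<phi>"
    by (rule homeomorphic_map_subtopologies_alt[OF chart_homeomorphic[OF M U]])
      (use chart_inj[OF M U] in \<open>auto dest: inj_onD\<close>)
  moreover have "\<phi> ` U \<inter> \<phi> ` (U \<inter> W) = \<phi> ` (U \<inter> W)" "W \<inter> (U \<inter> W) = U \<inter> W" "U \<inter> (U \<inter> W) = U \<inter> W"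
    by auto
  ultimately show "openin (subtopology (man_top M) W) (U \<inter> W) \<and>
    openin (Euclidean_space (man_dim M)) (\<phi> ` (U \<inter> W)) \<and>
    homeomorphic_map (subtopology (subtopology (man_top M) W) (U \<inter> W))
      (subtopology (Euclidean_space (man_dim M)) (\<phi> ` (U \<inter> W))) \<phi>"
    using UW W chart_image_subset_open[OF M U UW]
    by (simp add: subtopology_subtopology openin_open_subtopology)
next
  show "topspace (man_top (open_submanifold M W)) =
      (\<Union>(U, \<phi>)\<in>man_charts (open_submanifold M W). U)"
    using M by (auto simp: charted_def)
qed

lemma smooth_manifold_transition:
  assumes M: "smooth_manifold M" and U: "(U, \<phi>) \<in> man_charts M" and V: "(V, \<psi>) \<in> man_charts M"
    and j: "j < man_dim M"
  shows "smooth_on (man_dim M) (\<phi> ` (U \<inter> V)) (\<lambda>x. \<psi> (inv_into U \<phi> x) j)"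
proof -
  have "\<forall>(U, \<phi>) \<in> man_charts M. \<forall>(V, \<psi>) \<in> man_charts M.
      smooth_into (man_dim M) (man_dim M) (\<phi> ` (U \<inter> V)) (\<lambda>x. \<psi> (inv_into U \<phi> x))"
    using M unfolding smooth_manifold_def by (elim conjE)
  from bspec[OF bspec[OF this U, unfolded prod.case] V, unfolded prod.case] j
  show ?thesis by (simp add: smooth_into_def)
qed

lemma smooth_manifold_open_submanifold:
  assumes M: "smooth_manifold M" and W: "openin (man_top M) W"
  shows "smooth_manifold (open_submanifold M W)"
proof -
  note ch = smooth_manifold_imp_charted[OF M]
  have "smooth_into (man_dim M) (man_dim M) (\<phi> ` ((U \<inter> W) \<inter> (V \<inter> W)))
      (\<lambda>x. \<psi> (inv_into (U \<inter> W) \<phi> x))"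
    if U: "(U, \<phi>) \<in> man_charts M" and V: "(V, \<psi>) \<in> man_charts M" for U \<phi> V \<psi>
    unfolding smooth_into_def
  proof (intro allI impI)
    fix j assume j: "j < man_dim M"
    let ?Y = "(U \<inter> W) \<inter> (V \<inter> W)"
    have "smooth_on (man_dim M) (\<phi> ` (U \<inter> V)) (\<lambda>x. \<psi> (inv_into U \<phi> x) j)"
      using smooth_manifold_transition[OF M U V j] .
    then have "smooth_on (man_dim M) (\<phi> ` ?Y) (\<lambda>x. \<psi> (inv_into U \<phi> x) j)"
      by (rule smooth_on_subset) auto
    moreover have "openin (Euclidean_space (man_dim M)) (\<phi> ` ?Y)"
      using chart_open[OF ch U] chart_open[OF ch V] W
      by (intro chart_image_subset_open[OF ch U]) auto
    ultimately show "smooth_on (man_dim M) (\<phi> ` ?Y) (\<lambda>x. \<psi> (inv_into (U \<inter> W) \<phi> x) j)"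
    proof (rule smooth_on_cong[rotated 2])
      fix x assume "x \<in> \<phi> ` ?Y"
      then have "x \<in> \<phi> ` (U \<inter> W)" by blast
      then show "\<psi> (inv_into U \<phi> x) j = \<psi> (inv_into (U \<inter> W) \<phi> x) j"
        by (simp only: inv_into_Int[OF chart_inj[OF ch U]])
    qed
  qed
  then show ?thesis
    using charted_open_submanifold[OF ch W] M
    by (auto simp: smooth_manifold_def charted_def Hausdorff_space_subtopology second_countable_subtopology)
qed

text \<open>The target is cut down as well: over \<open>U\<close> a section has to become a map into
  \<open>bundle_over E U\<close>, the domain of a trivialization.\<close>

lemma smooth_map_restrict:
  assumes M: "charted M" and N: "charted N" and f: "smooth_map M N f"
    and U: "openin (man_top M) U" and V: "openin (man_top N) V"
    and sub: "\<And>p. p \<in> topspace (man_top M) \<Longrightarrow> p \<in> U \<Longrightarrow> f p \<in> V"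
  shows "smooth_map (open_submanifold M U) (open_submanifold N V) f"
  unfolding smooth_map_iff open_submanifold_simps
proof (intro conjI allI impI; (elim CollectE exE conjE Pair_inject)?)
  show cont: "continuous_map (subtopology (man_top M) U) (subtopology (man_top N) V) f"
    using smooth_map_continuous[OF f] sub
    by (auto simp: continuous_map_in_subtopology continuous_map_from_subtopology)
  fix A \<phi> B \<psi> j A0 \<phi>0 B0 \<psi>0
  assume "A = A0 \<inter> U" "\<phi> = \<phi>0" "B = B0 \<inter> V" "\<psi> = \<psi>0" and j: "j < man_dim N"
    and "(A0, \<phi>0) \<in> man_charts M" "(B0, \<psi>0) \<in> man_charts N"
  then have A: "A = A0 \<inter> U" "(A0, \<phi>) \<in> man_charts M" and B: "B = B0 \<inter> V" "(B0, \<psi>) \<in> man_charts N"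
    by auto
  have "smooth_on (man_dim M) (\<phi> ` {p \<in> A. f p \<in> B}) (\<lambda>x. \<psi> (f (inv_into A0 \<phi> x)) j)"
    by (rule smooth_on_subset[OF smooth_map_chartD[OF f A(2) B(2) j]]) (use A B in auto)
  moreover have "openin (Euclidean_space (man_dim M)) (\<phi> ` {p \<in> A. f p \<in> B})"
  proof (rule chart_image_subset_open[OF M A(2)])
    have "{p \<in> A. f p \<in> B} = {p \<in> A0. f p \<in> B} \<inter> U" using A by auto
    then show "openin (man_top M) {p \<in> A. f p \<in> B}"
      using chart_preimage_open[OF M A(2) smooth_map_continuous[OF f], of B] B(1) V
        chart_open[OF N B(2)] U by auto
  qed (use A in auto)
  ultimately show "smooth_on (man_dim M) (\<phi> ` {p \<in> A. f p \<in> B}) (\<lambda>x. \<psi> (f (inv_into A \<phi> x)) j)"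
    by (rule smooth_on_cong[rotated 2])
      (use inv_into_Int[OF chart_inj[OF M A(2)]] A(1) in \<open>fastforce simp: image_iff\<close>)
qed

text \<open>Glues maps whose target also varies with the point, as happens for sections rebuilt over
  different trivializations.\<close>

lemma smooth_map_local:
  assumes M: "charted M" and N: "charted N"
    and loc: "\<And>p. p \<in> topspace (man_top M) \<Longrightarrow> \<exists>U V. openin (man_top M) U \<and> p \<in> U \<and>
      openin (man_top N) V \<and> smooth_map (open_submanifold M U) (open_submanifold N V) f"
  shows "smooth_map M N f"
  unfolding smooth_map_iff
proof (intro conjI allI impI)
  show cont: "continuous_map (man_top M) (man_top N) f"
  proof (rule continuous_map_local)
    fix p assume "p \<in> topspace (man_top M)"
    then obtain U V where U: "openin (man_top M) U" "p \<in> U"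
      "smooth_map (open_submanifold M U) (open_submanifold N V) f"
      using loc by blast
    have "continuous_map (subtopology (man_top M) U) (man_top N) f"
      using smooth_map_continuous[OF U(3)] by (simp add: continuous_map_in_subtopology)
    with U show "\<exists>T. openin (man_top M) T \<and> p \<in> T \<and> continuous_map (subtopology (man_top M) T) (man_top N) f"
      by blast
  qed
  fix A \<phi> B \<psi> j
  assume A: "(A, \<phi>) \<in> man_charts M" and B: "(B, \<psi>) \<in> man_charts N" and j: "j < man_dim N"
  note inj = chart_inj[OF M A]
  let ?S = "{p \<in> A. f p \<in> B}"
  show "smooth_on (man_dim M) (\<phi> ` ?S) (\<lambda>x. \<psi> (f (inv_into A \<phi> x)) j)"
  proof (rule smooth_on_local, elim imageE CollectE conjE)
    fix x p assume x: "x = \<phi> p" "p \<in> A" "f p \<in> B"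
    then have p: "p \<in> topspace (man_top M)" using chart_subset[OF M A] by blast
    then obtain U V where U: "openin (man_top M) U" "p \<in> U" and V: "openin (man_top N) V"
      and f: "smooth_map (open_submanifold M U) (open_submanifold N V) f"
      using loc by blast
    \<comment> \<open>Continuity into the subtopology on \<open>V\<close> forces the values
      there.\<close>
    have "f p \<in> V"
      using continuous_map_funspace[OF smooth_map_continuous[OF f]] p U(2) by auto
    let ?T = "\<phi> ` {p \<in> A \<inter> U. f p \<in> B \<inter> V}"
    have "smooth_on (man_dim M) ?T (\<lambda>x. \<psi> (f (inv_into (A \<inter> U) \<phi> x)) j)"
      using smooth_map_chartD[OF f, of "A \<inter> U" \<phi> "B \<inter> V" \<psi> j] A B j by auto
    moreover have T: "openin (Euclidean_space (man_dim M)) ?T"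
    proof (rule chart_image_subset_open[OF M A])
      have "{p \<in> A \<inter> U. f p \<in> B \<inter> V} = {p \<in> A. f p \<in> B \<inter> V} \<inter> U" by auto
      then show "openin (man_top M) {p \<in> A \<inter> U. f p \<in> B \<inter> V}"
        using chart_preimage_open[OF M A cont, of "B \<inter> V"] V chart_open[OF N B] U by auto
    qed auto
    ultimately have "smooth_on (man_dim M) ?T (\<lambda>x. \<psi> (f (inv_into A \<phi> x)) j)"
      by (rule smooth_on_cong[rotated 2]) (use inv_into_Int[OF inj] in \<open>fastforce simp: image_iff\<close>)
    with T show "\<exists>T. openin (Euclidean_space (man_dim M)) T \<and> x \<in> T \<and> T \<subseteq> \<phi> ` ?S \<and>
        smooth_on (man_dim M) T (\<lambda>x. \<psi> (f (inv_into A \<phi> x)) j)"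
      using x U(2) \<open>f p \<in> V\<close> by (intro exI[of _ ?T]) auto
  qed
qed

section \<open>Maps into Euclidean space\<close>

lemma euclidean_manifold_simps [simp]:
  "man_top (euclidean_manifold n) = Euclidean_space n"
  "man_dim (euclidean_manifold n) = n"
  "man_charts (euclidean_manifold n) = {(topspace (Euclidean_space n), \<lambda>x. x)}"
  by (simp_all add: euclidean_manifold_def)

lemma charted_euclidean_manifold: "charted (euclidean_manifold n)"
  by (auto simp: charted_def subtopology_topspace homeomorphic_map_maps homeomorphic_maps_def
      intro!: exI[of _ "\<lambda>x. x"])

text \<open>The target has one global chart, the identity, so no preimages have to be cut out, and
  continuity follows from that of the coordinates in each chart.\<close>

lemma smooth_map_euclidean_iff:
  assumes M: "charted M"
  shows "smooth_map M (euclidean_manifold r) c \<longleftrightarrow>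
    c \<in> topspace (man_top M) \<rightarrow> topspace (Euclidean_space r) \<and>
    (\<forall>A \<phi> j. (A, \<phi>) \<in> man_charts M \<longrightarrow> j < r \<longrightarrow>
      smooth_on (man_dim M) (\<phi> ` A) (\<lambda>x. c (inv_into A \<phi> x) j))" (is "?L \<longleftrightarrow> ?R")
proof
  assume L: ?L
  then have c: "c \<in> topspace (man_top M) \<rightarrow> topspace (Euclidean_space r)"
    using continuous_map_funspace[OF smooth_map_continuous[OF L]] by simp
  have "smooth_on (man_dim M) (\<phi> ` A) (\<lambda>x. c (inv_into A \<phi> x) j)"
    if A: "(A, \<phi>) \<in> man_charts M" and j: "j < r" for A \<phi> j
  proof -
    have "{p \<in> A. c p \<in> topspace (Euclidean_space r)} = A"
      using c chart_subset[OF M A] by auto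
    then show ?thesis
      using smooth_map_chartD[OF L A, of "topspace (Euclidean_space r)" "\<lambda>x. x" j] j by simp
  qed
  with c show ?R by blast
next
  assume R: ?R
  show ?L
    unfolding smooth_map_iff
  proof (intro conjI allI impI)
    show "continuous_map (man_top M) (man_top (euclidean_manifold r)) c"
    proof (rule continuous_map_local)
      fix p assume "p \<in> topspace (man_top M)"
      then obtain A \<phi> where A: "(A, \<phi>) \<in> man_charts M" "p \<in> A"
        using charted_chart_exists[OF M] by metis
      have "continuous_map (subtopology (man_top M) A) euclideanreal (\<lambda>p. c p j)" if "j < r" for j
      proof -
        have "continuous_map (subtopology (Euclidean_space (man_dim M)) (\<phi> ` A)) euclideanreal
            (\<lambda>x. c (inv_into A \<phi> x) j)"
          using R A(1) that smooth_on_imp_continuous by blast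
        then have "continuous_map (subtopology (man_top M) A) euclideanreal
            (\<lambda>p. c (inv_into A \<phi> (\<phi> p)) j)"
          using homeomorphic_imp_continuous_map[OF chart_homeomorphic[OF M A(1)]]
            continuous_map_compose[unfolded o_def] by blast
        then show ?thesis
          by (rule continuous_map_eq) (use chart_inj[OF M A(1)] in auto)
      qed
      then have "continuous_map (subtopology (man_top M) A) (Euclidean_space r) c"
        using R by (auto simp: continuous_map_Euclidean_space_coordinatewise)
      then show "\<exists>T. openin (man_top M) T \<and> p \<in> T \<and>
          continuous_map (subtopology (man_top M) T) (man_top (euclidean_manifold r)) c"
        using A chart_open[OF M] by auto
    qed
    fix A \<phi> V \<psi> j
    assume "(A, \<phi>) \<in> man_charts M" "(V, \<psi>) \<in> man_charts (euclidean_manifold r)"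
      "j < man_dim (euclidean_manifold r)"
    then have "smooth_on (man_dim M) (\<phi> ` A) (\<lambda>x. c (inv_into A \<phi> x) j)" "\<psi> = (\<lambda>x. x)"
      using R by auto
    moreover have "\<phi> ` {p \<in> A. c p \<in> V} \<subseteq> \<phi> ` A" by auto
    ultimately show "smooth_on (man_dim M) (\<phi> ` {p \<in> A. c p \<in> V}) (\<lambda>x. \<psi> (c (inv_into A \<phi> x)) j)"
      by (simp only: smooth_on_subset)
  qed
qed


section \<open>Product manifolds and graphs\<close>

definition coord_append :: "nat \<Rightarrow> (nat \<Rightarrow> real) \<Rightarrow> (nat \<Rightarrow> real) \<Rightarrow> nat \<Rightarrow> real" where
  "coord_append d x y = (\<lambda>i. if i < d then x i else y (i - d))"

text \<open>The cut-off by 0 puts the result into \<open>Euclidean_space d\<close>;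
  \<open>coord_drop\<close> inherits its vanishing tail from the argument.\<close>

definition coord_take :: "nat \<Rightarrow> (nat \<Rightarrow> real) \<Rightarrow> nat \<Rightarrow> real" where
  "coord_take d z = (\<lambda>i. if i < d then z i else 0)"

definition coord_drop :: "nat \<Rightarrow> (nat \<Rightarrow> real) \<Rightarrow> nat \<Rightarrow> real" where
  "coord_drop d z = (\<lambda>i. z (i + d))"

lemma coord_take_append: "x \<in> topspace (Euclidean_space d) \<Longrightarrow> coord_take d (coord_append d x y) = x"
  by (auto simp: coord_take_def coord_append_def topspace_Euclidean_space)

lemma coord_drop_append: "coord_drop d (coord_append d x y) = y"
  by (auto simp: coord_drop_def coord_append_def)

lemma coord_append_take_drop: "coord_append d (coord_take d z) (coord_drop d z) = z"
  by (auto simp: coord_take_def coord_drop_def coord_append_def)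

lemma coord_append_in_Euclidean_space:
  "y \<in> topspace (Euclidean_space e) \<Longrightarrow> coord_append d x y \<in> topspace (Euclidean_space (d + e))"
  by (auto simp: coord_append_def topspace_Euclidean_space)

lemma continuous_map_coord_take:
  "continuous_map (Euclidean_space (d + e)) (Euclidean_space d) (coord_take d)"
  unfolding continuous_map_Euclidean_space_coordinatewise
  by (auto simp: coord_take_def topspace_Euclidean_space continuous_map_Euclidean_space_proj)

lemma continuous_map_coord_drop:
  "continuous_map (Euclidean_space (d + e)) (Euclidean_space e) (coord_drop d)"
  unfolding continuous_map_Euclidean_space_coordinatewise
  by (auto simp: coord_drop_def topspace_Euclidean_space continuous_map_Euclidean_space_proj)

lemma continuous_map_coord_append:
  assumes f: "continuous_map Y (Euclidean_space d) f" and g: "continuous_map Y (Euclidean_space e) g"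
  shows "continuous_map Y (Euclidean_space (d + e)) (\<lambda>p. coord_append d (f p) (g p))"
  unfolding continuous_map_Euclidean_space_coordinatewise
proof (intro conjI allI impI)
  show "(\<lambda>p. coord_append d (f p) (g p)) \<in> topspace Y \<rightarrow> topspace (Euclidean_space (d + e))"
    using continuous_map_funspace[OF g] coord_append_in_Euclidean_space by blast
  show "continuous_map Y euclideanreal (\<lambda>p. coord_append d (f p) (g p) j)" for j
    using continuous_map_compose[OF f continuous_map_Euclidean_space_proj, of j]
      continuous_map_compose[OF g continuous_map_Euclidean_space_proj, of "j - d"]
    by (cases "j < d") (simp_all add: coord_append_def o_def)
qed

lemma prod_manifold_simps [simp]:
  "man_top (prod_manifold M N) = prod_topology (man_top M) (man_top N)"
  "man_dim (prod_manifold M N) = man_dim M + man_dim N"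
  "man_charts (prod_manifold M N) =
     {(U \<times> V, \<lambda>(x, y). coord_append (man_dim M) (\<phi> x) (\<psi> y)) |U \<phi> V \<psi>.
        (U, \<phi>) \<in> man_charts M \<and> (V, \<psi>) \<in> man_charts N}"
  by (simp_all add: prod_manifold_def coord_append_def)

lemma charted_prod_manifold:
  assumes M: "charted M" and N: "charted N"
  shows "charted (prod_manifold M N)"
proof -
  let ?d = "man_dim M" and ?e = "man_dim N"
  have chart: "openin (prod_topology (man_top M) (man_top N)) (U \<times> V) \<and>
      openin (Euclidean_space (?d + ?e)) (\<alpha> ` (U \<times> V)) \<and>
      homeomorphic_map (subtopology (prod_topology (man_top M) (man_top N)) (U \<times> V))
        (subtopology (Euclidean_space (?d + ?e)) (\<alpha> ` (U \<times> V))) \<alpha>"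
    if U: "(U, \<phi>) \<in> man_charts M" and V: "(V, \<psi>) \<in> man_charts N"
      and \<alpha>_def: "\<alpha> = (\<lambda>(x, y). coord_append ?d (\<phi> x) (\<psi> y))" for U \<phi> V \<psi> \<alpha>
  proof -
    let ?E = "Euclidean_space (?d + ?e)"
    \<comment> \<open>The inverse of the product chart: separate the two blocks of coordinates, then
      invert each chart.\<close>
    define \<beta> where "\<beta> = (\<lambda>z. (inv_into U \<phi> (coord_take ?d z), inv_into V \<psi> (coord_drop ?d z)))"
    have \<phi>U: "\<phi> ` U \<subseteq> topspace (Euclidean_space ?d)" and \<psi>V: "\<psi> ` V \<subseteq> topspace (Euclidean_space ?e)"
      using chart_image_open[OF M U] chart_image_open[OF N V] openin_subset by blast+
    have take: "coord_take ?d (\<alpha> p) = \<phi> (fst p)" and drop: "coord_drop ?d (\<alpha> p) = \<psi> (snd p)"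
      and \<alpha>E: "\<alpha> p \<in> topspace ?E" if "p \<in> U \<times> V" for p
      using that \<phi>U \<psi>V
      by (auto simp: \<alpha>_def coord_take_append coord_drop_append intro: coord_append_in_Euclidean_space)
    \<comment> \<open>As an intersection of preimages under the continuous block projections, the
      image is visibly open.\<close>
    have img: "\<alpha> ` (U \<times> V) =
      {z \<in> topspace ?E. coord_take ?d z \<in> \<phi> ` U} \<inter> {z \<in> topspace ?E. coord_drop ?d z \<in> \<psi> ` V}"
    proof (intro equalityI subsetI)
      fix z assume "z \<in> \<alpha> ` (U \<times> V)"
      then obtain p where "p \<in> U \<times> V" "z = \<alpha> p" by blast
      then show "z \<in> {z \<in> topspace ?E. coord_take ?d z \<in> \<phi> ` U} \<inter>
          {z \<in> topspace ?E. coord_drop ?d z \<in> \<psi> ` V}"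
        using take[of p] drop[of p] \<alpha>E[of p] by auto
    next
      fix z assume "z \<in> {z \<in> topspace ?E. coord_take ?d z \<in> \<phi> ` U} \<inter>
          {z \<in> topspace ?E. coord_drop ?d z \<in> \<psi> ` V}"
      then obtain x y where "x \<in> U" "y \<in> V" "coord_take ?d z = \<phi> x" "coord_drop ?d z = \<psi> y"
        by auto
      then have "z = \<alpha> (x, y)" "(x, y) \<in> U \<times> V"
        using coord_append_take_drop[of ?d z] by (auto simp: \<alpha>_def)
      then show "z \<in> \<alpha> ` (U \<times> V)" by blast
    qed
    have img_open: "openin ?E (\<alpha> ` (U \<times> V))"
      unfolding img
      by (intro openin_Int openin_continuous_map_preimage[OF continuous_map_coord_take chart_image_open[OF M U]]
          openin_continuous_map_preimage[OF continuous_map_coord_drop chart_image_open[OF N V]])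
    have top: "subtopology (prod_topology (man_top M) (man_top N)) (U \<times> V) =
        prod_topology (subtopology (man_top M) U) (subtopology (man_top N) V)"
      by (simp add: subtopology_Times)
    have "continuous_map (prod_topology (subtopology (man_top M) U) (subtopology (man_top N) V)) ?E
        (\<lambda>p. coord_append ?d (\<phi> (fst p)) (\<psi> (snd p)))"
      using continuous_map_compose[OF continuous_map_fst chart_continuous[OF M U]]
        continuous_map_compose[OF continuous_map_snd chart_continuous[OF N V]]
      by (intro continuous_map_coord_append) (simp_all add: o_def)
    then have \<alpha>: "continuous_map (prod_topology (subtopology (man_top M) U) (subtopology (man_top N) V))
        (subtopology ?E (\<alpha> ` (U \<times> V))) \<alpha>"
      by (auto simp: continuous_map_in_subtopology \<alpha>_def case_prod_unfold)
    have "continuous_map (subtopology ?E (\<alpha> ` (U \<times> V))) (subtopology (Euclidean_space ?d) (\<phi> ` U)) (coord_take ?d)"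
      using continuous_map_from_subtopology[OF continuous_map_coord_take]
      by (auto simp: continuous_map_in_subtopology take)
    from continuous_map_compose[OF this chart_inv_continuous[OF M U]]
    have 1: "continuous_map (subtopology ?E (\<alpha> ` (U \<times> V))) (man_top M)
        (\<lambda>z. inv_into U \<phi> (coord_take ?d z))"
      by (simp add: o_def)
    have "continuous_map (subtopology ?E (\<alpha> ` (U \<times> V))) (subtopology (Euclidean_space ?e) (\<psi> ` V)) (coord_drop ?d)"
      using continuous_map_from_subtopology[OF continuous_map_coord_drop]
      by (auto simp: continuous_map_in_subtopology drop)
    from continuous_map_compose[OF this chart_inv_continuous[OF N V]]
    have 2: "continuous_map (subtopology ?E (\<alpha> ` (U \<times> V))) (man_top N)
        (\<lambda>z. inv_into V \<psi> (coord_drop ?d z))"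
      by (simp add: o_def)
    have \<beta>\<alpha>: "\<beta> (\<alpha> p) = p" if "p \<in> U \<times> V" for p
      using that take[OF that] drop[OF that] chart_inj[OF M U] chart_inj[OF N V]
      by (auto simp: \<beta>_def)
    have "continuous_map (subtopology ?E (\<alpha> ` (U \<times> V))) (prod_topology (man_top M) (man_top N)) \<beta>"
      using 1 2 by (simp add: \<beta>_def continuous_map_paired)
    then have \<beta>: "continuous_map (subtopology ?E (\<alpha> ` (U \<times> V)))
        (subtopology (prod_topology (man_top M) (man_top N)) (U \<times> V)) \<beta>"
      using \<beta>\<alpha> by (auto simp: continuous_map_in_subtopology)
    have "homeomorphic_maps (subtopology (prod_topology (man_top M) (man_top N)) (U \<times> V))
        (subtopology ?E (\<alpha> ` (U \<times> V))) \<alpha> \<beta>"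
      unfolding homeomorphic_maps_def using \<alpha>[folded top] \<beta> \<beta>\<alpha> by auto
    then show ?thesis
      using img_open chart_open[OF M U] chart_open[OF N V] homeomorphic_maps_imp_map
      by (auto simp: openin_prod_Times_iff)
  qed
  let ?P = "prod_manifold M N"
  have charts: "openin (man_top ?P) W \<and> openin (Euclidean_space (man_dim ?P)) (\<alpha> ` W) \<and>
      homeomorphic_map (subtopology (man_top ?P) W)
        (subtopology (Euclidean_space (man_dim ?P)) (\<alpha> ` W)) \<alpha>"
    if W: "(W, \<alpha>) \<in> man_charts ?P" for W \<alpha>
  proof -
    obtain U \<phi> V \<psi> where "(U, \<phi>) \<in> man_charts M" "(V, \<psi>) \<in> man_charts N" "W = U \<times> V"
      "\<alpha> = (\<lambda>(x, y). coord_append ?d (\<phi> x) (\<psi> y))"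
      using W by auto
    then show ?thesis using chart by simp
  qed
  moreover have "topspace (man_top ?P) = (\<Union>(W, \<alpha>)\<in>man_charts ?P. W)"
  proof (intro equalityI subsetI)
    fix p assume "p \<in> topspace (man_top ?P)"
    then obtain x y where p: "p = (x, y)" "x \<in> topspace (man_top M)" "y \<in> topspace (man_top N)"
      by auto
    obtain U \<phi> where "(U, \<phi>) \<in> man_charts M" "x \<in> U"
      by (rule charted_chart_exists[OF M p(2)])
    moreover obtain V \<psi> where "(V, \<psi>) \<in> man_charts N" "y \<in> V"
      by (rule charted_chart_exists[OF N p(3)])
    ultimately have "(U \<times> V, \<lambda>(x, y). coord_append ?d (\<phi> x) (\<psi> y)) \<in> man_charts ?P" "p \<in> U \<times> V"
      using p(1) by auto
    then show "p \<in> (\<Union>(W, \<alpha>)\<in>man_charts ?P. W)" by blast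
  next
    fix p assume "p \<in> (\<Union>(W, \<alpha>)\<in>man_charts ?P. W)"
    then obtain W \<alpha> where "(W, \<alpha>) \<in> man_charts ?P" "p \<in> W" by blast
    then show "p \<in> topspace (man_top ?P)"
      using charts openin_subset by blast
  qed
  ultimately show ?thesis
    unfolding charted_def by blast
qed

text \<open>In a product chart the second factor carries the identity chart, so coordinate
  \<open>j\<close> of \<open>snd\<close> is the coordinate function of index
  \<open>j + man_dim M\<close>.\<close>

lemma smooth_map_prod_euclidean_snd:
  assumes M: "charted M"
  shows "smooth_map (prod_manifold M (euclidean_manifold r)) (euclidean_manifold r) snd"
proof -
  let ?P = "prod_manifold M (euclidean_manifold r)" and ?R = "topspace (Euclidean_space r)"
  have P: "charted ?P"
    by (intro charted_prod_manifold M charted_euclidean_manifold)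
  have "smooth_on (man_dim ?P) (\<alpha> ` W) (\<lambda>z. snd (inv_into W \<alpha> z) j)"
    if W: "(W, \<alpha>) \<in> man_charts ?P" for W \<alpha> j
  proof (rule smooth_on_cong)
    show "openin (Euclidean_space (man_dim ?P)) (\<alpha> ` W)"
      by (rule chart_image_open[OF P W])
    show "smooth_on (man_dim ?P) (\<alpha> ` W) (\<lambda>z. z (j + man_dim M))"
      by (rule smooth_on_proj)
    fix z assume "z \<in> \<alpha> ` W"
    then obtain p where "p \<in> W" "z = \<alpha> p" by blast
    moreover have "\<alpha> p (j + man_dim M) = snd p j"
      using W by (auto simp: coord_append_def case_prod_unfold)
    ultimately show "z (j + man_dim M) = snd (inv_into W \<alpha> z) j"
      using chart_inj[OF P W] by simp
  qed
  then show ?thesis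
    by (subst smooth_map_euclidean_iff[OF P]) auto
qed

text \<open>The first \<open>man_dim M\<close> coordinates form a change of charts of
  \<open>M\<close>, which is why a compatible atlas is required; the others are the coordinates of
  \<open>c\<close>.\<close>

lemma smooth_map_graph:
  assumes M: "smooth_manifold M" and c: "smooth_map M (euclidean_manifold r) c"
  shows "smooth_map M (prod_manifold M (euclidean_manifold r)) (\<lambda>p. (p, c p))"
  unfolding smooth_map_iff
proof (intro conjI allI impI)
  note ch = smooth_manifold_imp_charted[OF M]
  let ?P = "prod_manifold M (euclidean_manifold r)" and ?d = "man_dim M"
  show "continuous_map (man_top M) (man_top ?P) (\<lambda>p. (p, c p))"
    using smooth_map_continuous[OF c] by (simp add: continuous_map_paired)
  fix U \<phi> W \<alpha> j
  assume U: "(U, \<phi>) \<in> man_charts M" and W: "(W, \<alpha>) \<in> man_charts ?P" and j: "j < man_dim ?P"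
  obtain V \<psi> where V: "(V, \<psi>) \<in> man_charts M" "W = V \<times> topspace (Euclidean_space r)"
    and \<alpha>: "\<alpha> = (\<lambda>(x, y). coord_append ?d (\<psi> x) y)"
    using W by auto
  have "{p \<in> U. (p, c p) \<in> W} = U \<inter> V"
    using V(2) c ch chart_subset[OF ch U] by (auto simp: smooth_map_euclidean_iff)
  moreover have "smooth_on ?d (\<phi> ` (U \<inter> V)) (\<lambda>x. \<alpha> (inv_into U \<phi> x, c (inv_into U \<phi> x)) j)"
  proof (cases "j < ?d")
    case True
    then show ?thesis
      using smooth_manifold_transition[OF M U V(1)] by (simp add: \<alpha> coord_append_def)
  next
    case False
    then have "smooth_on ?d (\<phi> ` U) (\<lambda>x. c (inv_into U \<phi> x) (j - ?d))"
      using c j U by (simp add: smooth_map_euclidean_iff[OF ch])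
    from smooth_on_subset[OF this, of "\<phi> ` (U \<inter> V)"] False show ?thesis
      by (simp add: \<alpha> coord_append_def image_mono)
  qed
  ultimately show "smooth_on ?d (\<phi> ` {p \<in> U. (p, c p) \<in> W})
      (\<lambda>x. \<alpha> (inv_into U \<phi> x, c (inv_into U \<phi> x)) j)"
    by simp
qed

section \<open>Smooth sections\<close>

lemma smooth_functions_simps [simp]:
  "carrier (smooth_functions M) = {f \<in> extensional (topspace (man_top M)).
     \<forall>(U, \<phi>) \<in> man_charts M. smooth_on (man_dim M) (\<phi> ` U) (\<lambda>x. f (inv_into U \<phi> x))}"
  "f \<otimes>\<^bsub>smooth_functions M\<^esub> g = (\<lambda>p\<in>topspace (man_top M). f p * g p)"
  "f \<oplus>\<^bsub>smooth_functions M\<^esub> g = (\<lambda>p\<in>topspace (man_top M). f p + g p)"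
  by (simp_all add: smooth_functions_def Let_def)

lemma smooth_sections_simps:
  "carrier (smooth_sections M E) = {\<psi> \<in> extensional (topspace (man_top M)).
     smooth_map M (total_space E) \<psi> \<and> (\<forall>p \<in> topspace (man_top M). bundle_proj E (\<psi> p) = p)}"
  "\<zero>\<^bsub>smooth_sections M E\<^esub> = (\<lambda>p\<in>topspace (man_top M). \<zero>\<^bsub>fibre E p\<^esub>)"
  "\<psi> \<oplus>\<^bsub>smooth_sections M E\<^esub> \<eta> = (\<lambda>p\<in>topspace (man_top M). \<psi> p \<oplus>\<^bsub>fibre E p\<^esub> \<eta> p)"
  "f \<odot>\<^bsub>smooth_sections M E\<^esub> \<psi> = (\<lambda>p\<in>topspace (man_top M). f p \<odot>\<^bsub>fibre E p\<^esub> \<psi> p)"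
  by (simp_all add: smooth_sections_def Let_def)

lemma carrier_real_ring [simp]: "carrier real_ring = UNIV"
  by (simp add: ring_of_type_algebra_def)

lemma zero_real_ring [simp]: "\<zero>\<^bsub>real_ring\<^esub> = 0"
  by (simp add: ring_of_type_algebra_def)

lemma coord_space_simps [simp]:
  "carrier (coord_space r) = topspace (Euclidean_space r)"
  "x \<oplus>\<^bsub>coord_space r\<^esub> y = (\<lambda>i. x i + y i)"
  "c \<odot>\<^bsub>coord_space r\<^esub> x = (\<lambda>i. c * x i)"
  by (simp_all add: coord_space_def)

lemma smooth_function_mult_smooth_map:
  assumes M: "charted M" and U: "openin (man_top M) U" and f: "f \<in> carrier (smooth_functions M)"
    and c: "smooth_map (open_submanifold M U) (euclidean_manifold r) c"
  shows "smooth_map (open_submanifold M U) (euclidean_manifold r) (\<lambda>p i. f p * c p i)"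
proof -
  note MU = charted_open_submanifold[OF M U]
  have "smooth_on (man_dim M) (\<phi> ` (A \<inter> U)) (\<lambda>x. f (inv_into (A \<inter> U) \<phi> x) * c (inv_into (A \<inter> U) \<phi> x) j)"
    if A: "(A, \<phi>) \<in> man_charts M" and j: "j < r" for A \<phi> j
  proof (rule smooth_on_mult)
    have AU: "(A \<inter> U, \<phi>) \<in> man_charts (open_submanifold M U)" using A by auto
    show op: "openin (Euclidean_space (man_dim M)) (\<phi> ` (A \<inter> U))"
      using chart_image_open[OF MU AU] by simp
    show "smooth_on (man_dim M) (\<phi> ` (A \<inter> U)) (\<lambda>x. c (inv_into (A \<inter> U) \<phi> x) j)"
      using c AU j unfolding smooth_map_euclidean_iff[OF MU] by (metis open_submanifold_simps(2))
    have "smooth_on (man_dim M) (\<phi> ` A) (\<lambda>x. f (inv_into A \<phi> x))"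
      using f A by auto
    then have "smooth_on (man_dim M) (\<phi> ` (A \<inter> U)) (\<lambda>x. f (inv_into A \<phi> x))"
      by (rule smooth_on_subset) auto
    then show "smooth_on (man_dim M) (\<phi> ` (A \<inter> U)) (\<lambda>x. f (inv_into (A \<inter> U) \<phi> x))"
      by (rule smooth_on_cong[OF op, rotated]) (simp only: inv_into_Int[OF chart_inj[OF M A]])
  qed
  \<comment> \<open>Coordinates from \<open>r\<close> on are 0 and remain 0 under
    multiplication.\<close>
  moreover have "(\<lambda>p i. f p * c p i) \<in> topspace (man_top (open_submanifold M U)) \<rightarrow> topspace (Euclidean_space r)"
    using c unfolding smooth_map_euclidean_iff[OF MU] by (auto simp: topspace_Euclidean_space Pi_iff)
  ultimately show ?thesis
    unfolding smooth_map_euclidean_iff[OF MU] by auto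
qed

section \<open>Sections in local trivializations\<close>

context
  fixes r :: nat and M :: "'a manifold" and E :: "('a, 'e) vbundle"
  assumes vb: "vector_bundle r M E"
begin

lemma vector_bundle_base: "smooth_manifold M" "charted M"
  using vb by (auto simp: vector_bundle_def intro: smooth_manifold_imp_charted)

lemma vector_bundle_total: "charted (total_space E)"
  using vb by (auto simp: vector_bundle_def intro: smooth_manifold_imp_charted)

lemma carrier_fibre: "p \<in> topspace (man_top M) \<Longrightarrow> carrier (fibre E p) = bundle_over E {p}"
  using vb by (auto simp: vector_bundle_def)

lemma module_fibre: "p \<in> topspace (man_top M) \<Longrightarrow> module real_ring (fibre E p)"
  using vb by (auto simp: vector_bundle_def)

lemma bundle_over_open:
  assumes "openin (man_top M) U"
  shows "openin (man_top (total_space E)) (bundle_over E U)"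
  using vb openin_continuous_map_preimage[OF smooth_map_continuous assms]
  unfolding bundle_over_def vector_bundle_def by blast

lemma section_in_fibre:
  assumes "\<psi> \<in> carrier (smooth_sections M E)" "p \<in> topspace (man_top M)"
  shows "\<psi> p \<in> carrier (fibre E p)"
  using assms continuous_map_funspace[OF smooth_map_continuous, of M "total_space E" \<psi>]
  by (auto simp: carrier_fibre smooth_sections_simps bundle_over_def)

context
  fixes U :: "'a set" and \<Phi> :: "'e \<Rightarrow> 'a \<times> (nat \<Rightarrow> real)"
  assumes triv: "local_trivialization r M E U \<Phi>"
begin

lemma trivialization_open: "openin (man_top M) U"
  using triv by (simp add: local_trivialization_def)

lemma trivialization_charted:
  "charted (open_submanifold M U)" "charted (open_submanifold (total_space E) (bundle_over E U))"
  "charted (prod_manifold (open_submanifold M U) (euclidean_manifold r))"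
  by (intro charted_open_submanifold charted_prod_manifold charted_euclidean_manifold
      vector_bundle_base vector_bundle_total trivialization_open bundle_over_open)+

lemma trivialization_smult:
  assumes "p \<in> U" "e \<in> carrier (fibre E p)"
  shows "snd (\<Phi> (c \<odot>\<^bsub>fibre E p\<^esub> e)) = (\<lambda>i. c * snd (\<Phi> e) i)"
  using triv assms by (auto simp: local_trivialization_def linear_maps_def)

text \<open>The zero vector is 0 times itself, so homogeneity of the trivialization decides.\<close>

lemma trivialization_zero:
  assumes "p \<in> U"
  shows "snd (\<Phi> \<zero>\<^bsub>fibre E p\<^esub>) = (\<lambda>i. 0)"
proof -
  have "p \<in> topspace (man_top M)" using assms trivialization_open openin_subset by blast
  then interpret fib: Module.module real_ring "fibre E p" by (rule module_fibre)
  have "snd (\<Phi> (0 \<odot>\<^bsub>fibre E p\<^esub> \<zero>\<^bsub>fibre E p\<^esub>)) = (\<lambda>i. 0)"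
    by (subst trivialization_smult[OF assms]) simp_all
  moreover have "0 \<odot>\<^bsub>fibre E p\<^esub> \<zero>\<^bsub>fibre E p\<^esub> = \<zero>\<^bsub>fibre E p\<^esub>"
    using fib.smult_l_null[of "\<zero>\<^bsub>fibre E p\<^esub>"] by simp
  ultimately show ?thesis by simp
qed

text \<open>The way down: the restricted section, then \<Phi>, then the second projection, all
  smooth.\<close>

lemma section_coordinates_smooth:
  assumes \<psi>: "\<psi> \<in> carrier (smooth_sections M E)"
  shows "smooth_map (open_submanifold M U) (euclidean_manifold r) (\<lambda>p. snd (\<Phi> (\<psi> p)))"
proof -
  have sm: "smooth_map M (total_space E) \<psi>" using \<psi> by (simp add: smooth_sections_simps)
  have "\<psi> p \<in> bundle_over E U" if "p \<in> topspace (man_top M)" "p \<in> U" for p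
    using section_in_fibre[OF \<psi> that(1)] that by (auto simp: carrier_fibre bundle_over_def)
  then have \<psi>U: "smooth_map (open_submanifold M U) (open_submanifold (total_space E) (bundle_over E U)) \<psi>"
    by (intro smooth_map_restrict vector_bundle_base vector_bundle_total sm trivialization_open
        bundle_over_open) auto
  have "smooth_map (open_submanifold (total_space E) (bundle_over E U))
      (prod_manifold (open_submanifold M U) (euclidean_manifold r)) \<Phi>"
    using triv by (auto simp: local_trivialization_def diffeomorphism_def)
  from smooth_map_compose[OF trivialization_charted \<psi>U this]
  show ?thesis
    by (rule smooth_map_compose[OF trivialization_charted(1,3) charted_euclidean_manifold])
      (rule smooth_map_prod_euclidean_snd[OF trivialization_charted(1)])
qed

text \<open>The way up: \<Phi> preserves base points, so the graph of the coordinates is \<Phi>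
  after \<open>s\<close>, and the smooth inverse of \<Phi> recovers \<open>s\<close> from
  it.\<close>

lemma smooth_map_of_coordinates:
  assumes s: "\<And>p. p \<in> topspace (man_top M) \<Longrightarrow> s p \<in> carrier (fibre E p)"
    and c: "smooth_map (open_submanifold M U) (euclidean_manifold r) (\<lambda>p. snd (\<Phi> (s p)))"
  shows "smooth_map (open_submanifold M U) (open_submanifold (total_space E) (bundle_over E U)) s"
proof -
  let ?W = "open_submanifold (total_space E) (bundle_over E U)"
  let ?P = "prod_manifold (open_submanifold M U) (euclidean_manifold r)"
  obtain g where g: "smooth_map ?P ?W g" "\<And>e. e \<in> topspace (man_top ?W) \<Longrightarrow> g (\<Phi> e) = e"
    using triv unfolding local_trivialization_def diffeomorphism_def by blast
  have "smooth_map (open_submanifold M U) ?P (\<lambda>p. (p, snd (\<Phi> (s p))))"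
    by (intro smooth_map_graph smooth_manifold_open_submanifold vector_bundle_base trivialization_open c)
  from smooth_map_compose[OF trivialization_charted(1,3,2) this g(1)]
  show ?thesis
  proof (rule smooth_map_cong[OF trivialization_charted(1,2)])
    fix p assume "p \<in> topspace (man_top (open_submanifold M U))"
    then have p: "p \<in> topspace (man_top M)" "p \<in> U" by auto
    then have sp: "s p \<in> topspace (man_top (total_space E))" "bundle_proj E (s p) = p"
      using s by (auto simp: carrier_fibre bundle_over_def)
    then have "s p \<in> bundle_over E U" using p by (simp add: bundle_over_def)
    then have "fst (\<Phi> (s p)) = p"
      using triv sp(2) by (simp add: local_trivialization_def)
    then have "(p, snd (\<Phi> (s p))) = \<Phi> (s p)" by (simp add: prod_eq_iff)
    then show "g (p, snd (\<Phi> (s p))) = s p"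
      using g(2)[of "s p"] sp(1) \<open>s p \<in> bundle_over E U\<close> by simp
  qed
qed

end

text \<open>Reduces smoothness into the total space to coordinates; trivializations exist around
  every point, and the pieces over them are glued.\<close>

lemma smooth_sectionI:
  assumes ext: "s \<in> extensional (topspace (man_top M))"
    and s: "\<And>p. p \<in> topspace (man_top M) \<Longrightarrow> s p \<in> carrier (fibre E p)"
    and c: "\<And>U \<Phi>. local_trivialization r M E U \<Phi> \<Longrightarrow>
      smooth_map (open_submanifold M U) (euclidean_manifold r) (\<lambda>p. snd (\<Phi> (s p)))"
  shows "s \<in> carrier (smooth_sections M E)"
proof -
  have "smooth_map M (total_space E) s"
  proof (rule smooth_map_local[OF vector_bundle_base(2) vector_bundle_total])
    fix p assume "p \<in> topspace (man_top M)"
    then obtain U \<Phi> where U: "p \<in> U" "local_trivialization r M E U \<Phi>"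
      using vb by (auto simp: vector_bundle_def)
    show "\<exists>U V. openin (man_top M) U \<and> p \<in> U \<and> openin (man_top (total_space E)) V \<and>
        smooth_map (open_submanifold M U) (open_submanifold (total_space E) V) s"
      using U(1) trivialization_open[OF U(2)] bundle_over_open[OF trivialization_open[OF U(2)]]
        smooth_map_of_coordinates[OF U(2) s c[OF U(2)]] by blast
  qed
  with ext s show ?thesis
    by (auto simp: smooth_sections_simps carrier_fibre bundle_over_def)
qed

text \<open>Fibrewise linearity of \<Phi> makes the coordinates of the product \<open>f\<close>
  times the coordinates of \<psi>.\<close>

lemma smult_section_closed:
  assumes f: "f \<in> carrier (smooth_functions M)" and \<psi>: "\<psi> \<in> carrier (smooth_sections M E)"
  shows "f \<odot>\<^bsub>smooth_sections M E\<^esub> \<psi> \<in> carrier (smooth_sections M E)"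
proof (rule smooth_sectionI)
  fix p assume p: "p \<in> topspace (man_top M)"
  interpret fib: Module.module real_ring "fibre E p" by (rule module_fibre[OF p])
  show "(f \<odot>\<^bsub>smooth_sections M E\<^esub> \<psi>) p \<in> carrier (fibre E p)"
    using p section_in_fibre[OF \<psi> p] by (simp add: smooth_sections_simps(4))
next
  fix U \<Phi> assume triv: "local_trivialization r M E U \<Phi>"
  note U = trivialization_open[OF triv]
  show "smooth_map (open_submanifold M U) (euclidean_manifold r)
      (\<lambda>p. snd (\<Phi> ((f \<odot>\<^bsub>smooth_sections M E\<^esub> \<psi>) p)))"
  proof (rule smooth_map_cong[OF trivialization_charted(1)[OF triv] charted_euclidean_manifold])
    show "smooth_map (open_submanifold M U) (euclidean_manifold r) (\<lambda>p i. f p * snd (\<Phi> (\<psi> p)) i)"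
      by (rule smooth_function_mult_smooth_map[OF vector_bundle_base(2) U f
            section_coordinates_smooth[OF triv \<psi>]])
    fix p assume "p \<in> topspace (man_top (open_submanifold M U))"
    then show "(\<lambda>i. f p * snd (\<Phi> (\<psi> p)) i) = snd (\<Phi> ((f \<odot>\<^bsub>smooth_sections M E\<^esub> \<psi>) p))"
      using section_in_fibre[OF \<psi>] trivialization_smult[OF triv]
      by (simp add: smooth_sections_simps(4))
  qed
qed (simp add: smooth_sections_simps(4))

lemma zero_section_closed: "\<zero>\<^bsub>smooth_sections M E\<^esub> \<in> carrier (smooth_sections M E)"
proof (rule smooth_sectionI)
  fix p assume p: "p \<in> topspace (man_top M)"
  interpret fib: Module.module real_ring "fibre E p" by (rule module_fibre[OF p])
  show "\<zero>\<^bsub>smooth_sections M E\<^esub> p \<in> carrier (fibre E p)"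
    using p by (simp add: smooth_sections_simps(2))
next
  fix U \<Phi> assume triv: "local_trivialization r M E U \<Phi>"
  show "smooth_map (open_submanifold M U) (euclidean_manifold r) (\<lambda>p. snd (\<Phi> (\<zero>\<^bsub>smooth_sections M E\<^esub> p)))"
  proof (rule smooth_map_cong[OF trivialization_charted(1)[OF triv] charted_euclidean_manifold])
    show "smooth_map (open_submanifold M U) (euclidean_manifold r) (\<lambda>p i. 0)"
      unfolding smooth_map_euclidean_iff[OF trivialization_charted(1)[OF triv]]
      by (simp add: topspace_Euclidean_space smooth_on_const)
    fix p assume "p \<in> topspace (man_top (open_submanifold M U))"
    then show "(\<lambda>i. 0) = snd (\<Phi> (\<zero>\<^bsub>smooth_sections M E\<^esub> p))"
      using trivialization_zero[OF triv] by (simp add: smooth_sections_simps(2))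
  qed
qed (simp add: smooth_sections_simps(2))

section \<open>Module identities for sections, checked fibre by fibre\<close>

lemma smult_zero_section:
  "f \<odot>\<^bsub>smooth_sections M E\<^esub> \<zero>\<^bsub>smooth_sections M E\<^esub> = \<zero>\<^bsub>smooth_sections M E\<^esub>"
proof -
  have "f p \<odot>\<^bsub>fibre E p\<^esub> \<zero>\<^bsub>fibre E p\<^esub> = \<zero>\<^bsub>fibre E p\<^esub>" if "p \<in> topspace (man_top M)" for p
  proof -
    interpret fib: Module.module real_ring "fibre E p" by (rule module_fibre[OF that])
    show ?thesis by (simp add: fib.smult_r_null)
  qed
  then show ?thesis by (auto simp: smooth_sections_simps)
qed

lemma add_zero_section:
  assumes "\<psi> \<in> carrier (smooth_sections M E)"
  shows "\<psi> \<oplus>\<^bsub>smooth_sections M E\<^esub> \<zero>\<^bsub>smooth_sections M E\<^esub> = \<psi>"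
proof (rule extensionalityI[of _ "topspace (man_top M)"])
  fix p assume p: "p \<in> topspace (man_top M)"
  interpret fib: Module.module real_ring "fibre E p" by (rule module_fibre[OF p])
  show "(\<psi> \<oplus>\<^bsub>smooth_sections M E\<^esub> \<zero>\<^bsub>smooth_sections M E\<^esub>) p = \<psi> p"
    using p section_in_fibre[OF assms p] by (simp add: smooth_sections_simps(2,3))
qed (use assms in \<open>simp_all add: smooth_sections_simps\<close>)

lemma add_sections_commute:
  assumes "\<psi> \<in> carrier (smooth_sections M E)" "\<eta> \<in> carrier (smooth_sections M E)"
  shows "\<psi> \<oplus>\<^bsub>smooth_sections M E\<^esub> \<eta> = \<eta> \<oplus>\<^bsub>smooth_sections M E\<^esub> \<psi>"
proof (rule extensionalityI[of _ "topspace (man_top M)"])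
  fix p assume p: "p \<in> topspace (man_top M)"
  interpret fib: Module.module real_ring "fibre E p" by (rule module_fibre[OF p])
  show "(\<psi> \<oplus>\<^bsub>smooth_sections M E\<^esub> \<eta>) p = (\<eta> \<oplus>\<^bsub>smooth_sections M E\<^esub> \<psi>) p"
    using p assms[THEN section_in_fibre, OF p]
    by (simp add: smooth_sections_simps(3) fib.M.a_comm)
qed (simp_all add: smooth_sections_simps(3))

text \<open>The regrouping that turns the sum of the rules for \<open>f w\<close> and
  \<open>g v\<close> into the section component of the Leibniz rule in the algebra.\<close>

lemma add_sections_four:
  assumes "a \<in> carrier (smooth_sections M E)" "b \<in> carrier (smooth_sections M E)"
    "c \<in> carrier (smooth_sections M E)" "d \<in> carrier (smooth_sections M E)"
  shows "(a \<oplus>\<^bsub>smooth_sections M E\<^esub> b) \<oplus>\<^bsub>smooth_sections M E\<^esub> (c \<oplus>\<^bsub>smooth_sections M E\<^esub> d) =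
    (b \<oplus>\<^bsub>smooth_sections M E\<^esub> c) \<oplus>\<^bsub>smooth_sections M E\<^esub> (a \<oplus>\<^bsub>smooth_sections M E\<^esub> d)"
proof (rule extensionalityI[of _ "topspace (man_top M)"])
  fix p assume p: "p \<in> topspace (man_top M)"
  interpret fib: Module.module real_ring "fibre E p" by (rule module_fibre[OF p])
  show "((a \<oplus>\<^bsub>smooth_sections M E\<^esub> b) \<oplus>\<^bsub>smooth_sections M E\<^esub> (c \<oplus>\<^bsub>smooth_sections M E\<^esub> d)) p =
    ((b \<oplus>\<^bsub>smooth_sections M E\<^esub> c) \<oplus>\<^bsub>smooth_sections M E\<^esub> (a \<oplus>\<^bsub>smooth_sections M E\<^esub> d)) p"
    using p assms[THEN section_in_fibre, OF p]
    by (simp add: smooth_sections_simps(3) fib.M.a_ac)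
qed (simp_all add: smooth_sections_simps(3))

text \<open>Real scalars act through constant functions, and the constant function of value 0
  annihilates each fibre.\<close>

lemma smult_zero_section_space:
  assumes "\<psi> \<in> carrier (smooth_sections M E)"
  shows "0 \<odot>\<^bsub>section_space M E\<^esub> \<psi> = \<zero>\<^bsub>smooth_sections M E\<^esub>"
proof -
  have "0 \<odot>\<^bsub>fibre E p\<^esub> \<psi> p = \<zero>\<^bsub>fibre E p\<^esub>" if p: "p \<in> topspace (man_top M)" for p
  proof -
    interpret fib: Module.module real_ring "fibre E p" by (rule module_fibre[OF p])
    show ?thesis
      using fib.smult_l_null[OF section_in_fibre[OF assms p]] by simp
  qed
  then show ?thesis
    by (auto simp: section_space_def restrict_scalars_def smooth_sections_simps smooth_functions_def Let_def)
qed

text \<open>Homogeneity alone: the zero section is 0 times itself, so its image is 0 times a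
  section.\<close>

lemma linear_map_zero_section:
  assumes "u \<in> linear_maps real_ring (section_space M E) (section_space M E)"
  shows "u \<zero>\<^bsub>smooth_sections M E\<^esub> = \<zero>\<^bsub>smooth_sections M E\<^esub>"
proof -
  let ?z = "\<zero>\<^bsub>smooth_sections M E\<^esub>"
  have carrier: "carrier (section_space M E) = carrier (smooth_sections M E)"
    by (simp add: section_space_def restrict_scalars_def)
  have "u (0 \<odot>\<^bsub>section_space M E\<^esub> ?z) = 0 \<odot>\<^bsub>section_space M E\<^esub> u ?z" "u ?z \<in> carrier (smooth_sections M E)"
    using assms zero_section_closed unfolding linear_maps_def carrier by auto
  then show ?thesis
    using smult_zero_section_space zero_section_closed by metis
qed

end

section \<open>The Leibniz rule in the square-zero extension\<close>

lemma square_zero_extension_simps [simp]: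
  "carrier (square_zero_extension C V) = carrier C \<times> carrier V"
  "(f, v) \<otimes>\<^bsub>square_zero_extension C V\<^esub> (g, w) = (f \<otimes>\<^bsub>C\<^esub> g, f \<odot>\<^bsub>V\<^esub> w \<oplus>\<^bsub>V\<^esub> g \<odot>\<^bsub>V\<^esub> v)"
  "(f, v) \<oplus>\<^bsub>square_zero_extension C V\<^esub> (g, w) = (f \<oplus>\<^bsub>C\<^esub> g, v \<oplus>\<^bsub>V\<^esub> w)"
  "c \<odot>\<^bsub>square_zero_extension C V\<^esub> (f, v) = (c \<odot>\<^bsub>C\<^esub> f, c \<odot>\<^bsub>restrict_scalars C V\<^esub> v)"
  by (simp_all add: square_zero_extension_def)

lemma restrict_scalars_simps [simp]:
  "carrier (restrict_scalars C V) = carrier V"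
  "v \<oplus>\<^bsub>restrict_scalars C V\<^esub> w = v \<oplus>\<^bsub>V\<^esub> w"
  by (simp_all add: restrict_scalars_def)

lemma map_prod_in_linear_maps:
  assumes "a \<in> linear_maps R C C" "b \<in> linear_maps R (restrict_scalars C V) (restrict_scalars C V)"
  shows "map_prod a b \<in> linear_maps R (square_zero_extension C V) (square_zero_extension C V)"
  using assms by (auto simp: linear_maps_def Pi_iff)

theorem proposition6p4:
  fixes M :: "'a manifold" and E :: "('a, 'e) vbundle" and r :: nat
    and u\<^sub>M :: "('a \<Rightarrow> real) \<Rightarrow> ('a \<Rightarrow> real)" and u :: "('a \<Rightarrow> 'e) \<Rightarrow> ('a \<Rightarrow> 'e)"
  assumes "vector_bundle r M E"
    and "u\<^sub>M \<in> linear_maps real_ring (smooth_functions M) (smooth_functions M)"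
    and "u \<in> linear_maps real_ring (section_space M E) (section_space M E)"
  shows "derivation real_ring (bundle_algebra M E) (map_prod u\<^sub>M u) \<longleftrightarrow>
    derivation real_ring (smooth_functions M) u\<^sub>M \<and> derivative_endomorphism M E u\<^sub>M u"
proof -
  define C where "C = smooth_functions M"
  define S where "S = smooth_sections M E"
  note vb = assms(1)
  have uM: "u\<^sub>M f \<in> carrier C" if "f \<in> carrier C" for f
    using assms(2) that by (auto simp: linear_maps_def C_def simp del: smooth_functions_simps)
  have u: "u \<psi> \<in> carrier S" if "\<psi> \<in> carrier S" for \<psi>
    using assms(3) that by (auto simp: linear_maps_def S_def section_space_def)
  have u_add: "u (\<psi> \<oplus>\<^bsub>S\<^esub> \<eta>) = u \<psi> \<oplus>\<^bsub>S\<^esub> u \<eta>" if "\<psi> \<in> carrier S" "\<eta> \<in> carrier S" for \<psi> \<eta>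
    using assms(3) that by (auto simp: linear_maps_def S_def section_space_def)
  have smult: "f \<odot>\<^bsub>S\<^esub> \<psi> \<in> carrier S" if "f \<in> carrier C" "\<psi> \<in> carrier S" for f \<psi>
    using smult_section_closed[OF vb] that unfolding C_def S_def .
  note zero = zero_section_closed[OF vb, folded S_def] smult_zero_section[OF vb, folded S_def]
    add_zero_section[OF vb, folded S_def] linear_map_zero_section[OF vb assms(3), folded S_def]
  note comm = add_sections_commute[OF vb, folded S_def] and four = add_sections_four[OF vb, folded S_def]
  have lin: "map_prod u\<^sub>M u \<in> linear_maps real_ring (bundle_algebra M E) (bundle_algebra M E)"
    unfolding bundle_algebra_def
    by (rule map_prod_in_linear_maps[OF assms(2) assms(3)[unfolded section_space_def]])
  \<comment> \<open>Linearity is settled by \<open>lin\<close>, so only the product rule remains;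
    the two components of the pair give the two equations.\<close>
  have "derivation real_ring (bundle_algebra M E) (map_prod u\<^sub>M u) \<longleftrightarrow>
    (\<forall>f \<in> carrier C. \<forall>v \<in> carrier S. \<forall>g \<in> carrier C. \<forall>w \<in> carrier S.
      u\<^sub>M (f \<otimes>\<^bsub>C\<^esub> g) = u\<^sub>M f \<otimes>\<^bsub>C\<^esub> g \<oplus>\<^bsub>C\<^esub> f \<otimes>\<^bsub>C\<^esub> u\<^sub>M g \<and>
      u (f \<odot>\<^bsub>S\<^esub> w \<oplus>\<^bsub>S\<^esub> g \<odot>\<^bsub>S\<^esub> v) =
        (u\<^sub>M f \<odot>\<^bsub>S\<^esub> w \<oplus>\<^bsub>S\<^esub> g \<odot>\<^bsub>S\<^esub> u v) \<oplus>\<^bsub>S\<^esub> (f \<odot>\<^bsub>S\<^esub> u w \<oplus>\<^bsub>S\<^esub> u\<^sub>M g \<odot>\<^bsub>S\<^esub> v))"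
    (is "_ \<longleftrightarrow> ?L")
    using lin unfolding derivation_def bundle_algebra_def C_def S_def
    by (simp add: Ball_def del: smooth_functions_simps) blast
  also have "?L \<longleftrightarrow>
    (\<forall>f \<in> carrier C. \<forall>g \<in> carrier C. u\<^sub>M (f \<otimes>\<^bsub>C\<^esub> g) = u\<^sub>M f \<otimes>\<^bsub>C\<^esub> g \<oplus>\<^bsub>C\<^esub> f \<otimes>\<^bsub>C\<^esub> u\<^sub>M g) \<and>
    (\<forall>f \<in> carrier C. \<forall>w \<in> carrier S. u (f \<odot>\<^bsub>S\<^esub> w) = f \<odot>\<^bsub>S\<^esub> u w \<oplus>\<^bsub>S\<^esub> u\<^sub>M f \<odot>\<^bsub>S\<^esub> w)"
    (is "_ \<longleftrightarrow> ?D \<and> ?R")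
  proof (intro iffI conjI)
    assume L: ?L
    \<comment> \<open>The zero section provides values for \<open>v\<close> and \<open>w\<close>,
      without which the quantifiers over sections could be vacuous.\<close>
    show ?D using L zero(1) by blast
    show ?R
    proof (intro ballI)
      fix f w assume fw: "f \<in> carrier C" "w \<in> carrier S"
      let ?z = "\<zero>\<^bsub>S\<^esub>"
      have "u (f \<odot>\<^bsub>S\<^esub> w \<oplus>\<^bsub>S\<^esub> f \<odot>\<^bsub>S\<^esub> ?z) =
        (u\<^sub>M f \<odot>\<^bsub>S\<^esub> w \<oplus>\<^bsub>S\<^esub> f \<odot>\<^bsub>S\<^esub> u ?z) \<oplus>\<^bsub>S\<^esub> (f \<odot>\<^bsub>S\<^esub> u w \<oplus>\<^bsub>S\<^esub> u\<^sub>M f \<odot>\<^bsub>S\<^esub> ?z)"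
        using L fw zero(1) by blast
      then have "u (f \<odot>\<^bsub>S\<^esub> w) = (u\<^sub>M f \<odot>\<^bsub>S\<^esub> w \<oplus>\<^bsub>S\<^esub> ?z) \<oplus>\<^bsub>S\<^esub> (f \<odot>\<^bsub>S\<^esub> u w \<oplus>\<^bsub>S\<^esub> ?z)"
        using fw by (simp add: zero smult)
      also have "\<dots> = u\<^sub>M f \<odot>\<^bsub>S\<^esub> w \<oplus>\<^bsub>S\<^esub> f \<odot>\<^bsub>S\<^esub> u w"
        using fw by (simp add: zero smult u uM)
      also have "\<dots> = f \<odot>\<^bsub>S\<^esub> u w \<oplus>\<^bsub>S\<^esub> u\<^sub>M f \<odot>\<^bsub>S\<^esub> w"
        by (rule comm) (use fw smult u uM in auto)
      finally show "u (f \<odot>\<^bsub>S\<^esub> w) = f \<odot>\<^bsub>S\<^esub> u w \<oplus>\<^bsub>S\<^esub> u\<^sub>M f \<odot>\<^bsub>S\<^esub> w" .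
    qed
  next
    assume DR: "?D \<and> ?R"
    show ?L
    proof (intro ballI conjI)
      fix f v g w
      assume *: "f \<in> carrier C" "v \<in> carrier S" "g \<in> carrier C" "w \<in> carrier S"
      show "u\<^sub>M (f \<otimes>\<^bsub>C\<^esub> g) = u\<^sub>M f \<otimes>\<^bsub>C\<^esub> g \<oplus>\<^bsub>C\<^esub> f \<otimes>\<^bsub>C\<^esub> u\<^sub>M g"
        using DR * by blast
      \<comment> \<open>Additivity of \<open>u\<close> applies because both products are smooth
        sections; each summand then obeys its own rule.\<close>
      have "u (f \<odot>\<^bsub>S\<^esub> w \<oplus>\<^bsub>S\<^esub> g \<odot>\<^bsub>S\<^esub> v) =
        (f \<odot>\<^bsub>S\<^esub> u w \<oplus>\<^bsub>S\<^esub> u\<^sub>M f \<odot>\<^bsub>S\<^esub> w) \<oplus>\<^bsub>S\<^esub> (g \<odot>\<^bsub>S\<^esub> u v \<oplus>\<^bsub>S\<^esub> u\<^sub>M g \<odot>\<^bsub>S\<^esub> v)"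
        using DR * by (simp add: u_add smult)
      also have "\<dots> = (u\<^sub>M f \<odot>\<^bsub>S\<^esub> w \<oplus>\<^bsub>S\<^esub> g \<odot>\<^bsub>S\<^esub> u v) \<oplus>\<^bsub>S\<^esub> (f \<odot>\<^bsub>S\<^esub> u w \<oplus>\<^bsub>S\<^esub> u\<^sub>M g \<odot>\<^bsub>S\<^esub> v)"
        by (rule four) (use * uM u smult in auto)
      finally show "u (f \<odot>\<^bsub>S\<^esub> w \<oplus>\<^bsub>S\<^esub> g \<odot>\<^bsub>S\<^esub> v) =
        (u\<^sub>M f \<odot>\<^bsub>S\<^esub> w \<oplus>\<^bsub>S\<^esub> g \<odot>\<^bsub>S\<^esub> u v) \<oplus>\<^bsub>S\<^esub> (f \<odot>\<^bsub>S\<^esub> u w \<oplus>\<^bsub>S\<^esub> u\<^sub>M g \<odot>\<^bsub>S\<^esub> v)" .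
    qed
  qed
  \<comment> \<open>The linearity clauses of both notions are hypotheses and can be put
    back.\<close>
  also have "\<dots> \<longleftrightarrow> derivation real_ring (smooth_functions M) u\<^sub>M \<and> derivative_endomorphism M E u\<^sub>M u"
    using assms(2,3) by (simp only: derivation_def derivative_endomorphism_def C_def S_def simp_thms)
  finally show ?thesis .
qed

end
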